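(* The permutations $312$ and $23514$ form an annihilator pair: for every permutation $\tau$ and every pair of distinct indices $i,j\le|\tau|$, the permutation $\tau_{i,j}[312,23514]$ satisfies $\mu[1,\tau_{i,j}[312,23514]]=0$.
   Context: Permutations are ordered by containment: $\sigma\le\pi$ if $\pi$ has a subsequence order-isomorphic to $\sigma$. The Möbius function: $\mu[\sigma,\pi]=0$ if $\sigma\not\le\pi$, $\mu[\sigma,\pi]=1$ if $\sigma=\pi$, and $\mu[\sigma,\pi]=-\sum_{\sigma\le\tau<\pi}\mu[\sigma,\tau]$ otherwise; $1$ is the permutation of length one. For a permutation $\tau$ of length $m$, distinct indices $i,j\le m$ and non-empty permutations $\phi,\psi$, the inflation $\tau_{i,j}[\phi,\psi]$ is the permutation obtained from $\tau$ by replacing the entry $\tau_i$ by a block of $|\phi|$ consecutive positions whose values form a set of consecutive integers and are order-isomorphic to $\phi$, replacing $\tau_j$ likewise by a block order-isomorphic to $\psi$, and keeping every other entry as a single entry, so that the relative order between different blocks/entries is that of the corresponding entries of $\tau$. *)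

theory Defs
  imports "HOL-Combinatorics.Multiset_Permutations" "HOL-Library.Sublist"
begin

text \<open>
  Permutations are lists in one-line notation with values \<open>1, \<dots>, n\<close>; positions are
  list indices, hence counted from \<open>0\<close>.
\<close>

definition is_perm :: "nat list \<Rightarrow> bool" where
  "is_perm p \<longleftrightarrow> p \<in> permutations_of_set {1..length p}"

definition order_iso :: "nat list \<Rightarrow> nat list \<Rightarrow> bool" where
  "order_iso xs ys \<longleftrightarrow> length xs = length ys \<and>
     (\<forall>i < length xs. \<forall>j < length xs. xs ! i < xs ! j \<longleftrightarrow> ys ! i < ys ! j)"

definition perm_le :: "nat list \<Rightarrow> nat list \<Rightarrow> bool" (infix "\<preceq>" 50) where
  "\<sigma> \<preceq> \<pi> \<longleftrightarrow> is_perm \<sigma> \<and> is_perm \<pi> \<and> (\<exists>xs. subseq xs \<pi> \<and> order_iso xs \<sigma>)"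

definition perm_less :: "nat list \<Rightarrow> nat list \<Rightarrow> bool" (infix "\<prec>" 50) where
  "\<sigma> \<prec> \<pi> \<longleftrightarrow> \<sigma> \<preceq> \<pi> \<and> \<sigma> \<noteq> \<pi>"

lemma is_perm_iff: "is_perm p \<longleftrightarrow> set p = {1..length p} \<and> distinct p"
  by (auto simp: is_perm_def permutations_of_set_def)

lemma perm_nth_eq_card:
  assumes "is_perm p" "i < length p"
  shows "p ! i = Suc (card {j. j < length p \<and> p ! j < p ! i})"
proof -
  have d: "distinct p" and s: "set p = {1..length p}" using assms by (auto simp: is_perm_iff)
  have m: "p ! i \<in> {1..length p}" using assms s nth_mem by blast
  have inj: "inj_on ((!) p) {j. j < length p \<and> p ! j < p ! i}"
    using d by (auto simp: inj_on_def nth_eq_iff_index_eq)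
  have "(!) p ` {j. j < length p \<and> p ! j < p ! i} = {v \<in> set p. v < p ! i}"
    by (auto simp: in_set_conv_nth)
  also have "\<dots> = {1..<p ! i}" using s m by auto
  finally have "card {j. j < length p \<and> p ! j < p ! i} = p ! i - 1"
    using card_image[OF inj] by simp
  then show ?thesis using m by auto
qed

lemma order_iso_perm_eq:
  assumes "is_perm p" "is_perm q" "order_iso p q"
  shows "p = q"
proof (rule nth_equalityI)
  show l: "length p = length q" using assms by (simp add: order_iso_def)
  fix i assume i: "i < length p"
  then have "{j. j < length p \<and> p ! j < p ! i} = {j. j < length q \<and> q ! j < q ! i}"
    using assms(3) by (auto simp: order_iso_def)
  then show "p ! i = q ! i"
    using perm_nth_eq_card[OF assms(1) i] perm_nth_eq_card[OF assms(2), of i] i l by simp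
qed

lemma perm_less_length: "\<sigma> \<prec> \<pi> \<Longrightarrow> length \<sigma> < length \<pi>"
proof -
  assume a: "\<sigma> \<prec> \<pi>"
  then obtain xs where xs: "subseq xs \<pi>" "order_iso xs \<sigma>"
    by (auto simp: perm_less_def perm_le_def)
  have p: "is_perm \<sigma>" "is_perm \<pi>" "\<sigma> \<noteq> \<pi>" using a by (auto simp: perm_less_def perm_le_def)
  have l: "length xs = length \<sigma>" using xs by (simp add: order_iso_def)
  moreover have "length xs \<noteq> length \<pi>"
    using subseq_same_length[OF xs(1)] order_iso_perm_eq[OF p(2,1)] xs p(3) by auto
  ultimately show ?thesis using list_emb_length[OF xs(1)] by simp
qed

function mobius :: "nat list \<Rightarrow> nat list \<Rightarrow> int" where
  "mobius \<sigma> \<pi> =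
     (if \<not> \<sigma> \<preceq> \<pi> then 0
      else if \<sigma> = \<pi> then 1
      else - (\<Sum>\<tau> \<in> {\<tau>. \<sigma> \<preceq> \<tau> \<and> \<tau> \<prec> \<pi>}. mobius \<sigma> \<tau>))"
  by auto
termination
  by (relation "measure (\<lambda>(\<sigma>, \<pi>). length \<pi>)") (auto dest: perm_less_length)

declare mobius.simps [simp del]

lemma finite_perm_less: "finite {\<tau>. \<sigma> \<preceq> \<tau> \<and> \<tau> \<prec> \<pi>}"
proof (rule finite_subset)
  show "{\<tau>. \<sigma> \<preceq> \<tau> \<and> \<tau> \<prec> \<pi>} \<subseteq> {xs. set xs \<subseteq> {1..length \<pi>} \<and> length xs \<le> length \<pi>}"
    by (auto dest!: perm_less_length simp: perm_le_def is_perm_iff)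
  show "finite {xs. set xs \<subseteq> {1..length \<pi>} \<and> length xs \<le> length \<pi>}"
    by (rule finite_lists_length_le) simp
qed

text \<open>
  The block replacing the entry \<open>\<tau> ! k\<close> is \<open>bs ! k\<close>; its values are shifted past the
  total size of the blocks that replace smaller entries of \<open>\<tau>\<close>.
\<close>

definition inflate :: "nat list \<Rightarrow> nat list list \<Rightarrow> nat list" where
  "inflate \<tau> bs =
     concat (map (\<lambda>k. map (\<lambda>v. (\<Sum>l | l < length \<tau> \<and> \<tau> ! l < \<tau> ! k. length (bs ! l)) + v) (bs ! k))
       [0..<length \<tau>])"

definition inflate2 :: "nat list \<Rightarrow> nat \<Rightarrow> nat \<Rightarrow> nat list \<Rightarrow> nat list \<Rightarrow> nat list" where
  "inflate2 \<tau> i j \<phi> \<psi> = inflate \<tau> ((replicate (length \<tau>) [1])[i := \<phi>, j := \<psi>])"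

definition annihilator_pair :: "nat list \<Rightarrow> nat list \<Rightarrow> bool" where
  "annihilator_pair \<phi> \<psi> \<longleftrightarrow>
     is_perm \<phi> \<and> \<phi> \<noteq> [] \<and> is_perm \<psi> \<and> \<psi> \<noteq> [] \<and>
     (\<forall>\<tau> i j. is_perm \<tau> \<and> i < length \<tau> \<and> j < length \<tau> \<and> i \<noteq> j
        \<longrightarrow> mobius [1] (inflate2 \<tau> i j \<phi> \<psi>) = 0)"

lemma is_perm_inflate:
  assumes \<tau>: "is_perm \<tau>" and len: "length bs = length \<tau>" and bs: "\<forall>b \<in> set bs. is_perm b"
  shows "is_perm (inflate \<tau> bs)"
proof -
  define n where "n = length \<tau>"
  define N where "N = (\<Sum>l<n. length (bs ! l))"
  define off where "off k = (\<Sum>l | l < n \<and> \<tau> ! l < \<tau> ! k. length (bs ! l))" for k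
  define B where "B k = map (\<lambda>v. off k + v) (bs ! k)" for k
  have infl: "inflate \<tau> bs = concat (map B [0..<n])"
    by (simp add: inflate_def B_def[abs_def] off_def n_def)
  have pb: "is_perm (bs ! k)" if "k < n" for k using that bs len by (simp add: n_def)
  have d\<tau>: "distinct \<tau>" using \<tau> by (simp add: is_perm_iff)
  have sB: "set (B k) = {off k + 1..off k + length (bs ! k)}" if "k < n" for k
    using pb[OF that] by (simp add: B_def is_perm_iff)
  have dB: "distinct (B k)" if "k < n" for k
    using pb[OF that] by (simp add: B_def is_perm_iff distinct_map)
  have step: "off k + length (bs ! k) \<le> off l" if "k < n" "l < n" "\<tau> ! k < \<tau> ! l" for k l
  proof -
    have "off k + length (bs ! k) = (\<Sum>m \<in> insert k {m. m < n \<and> \<tau> ! m < \<tau> ! k}. length (bs ! m))"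
      by (simp add: off_def)
    also have "\<dots> \<le> off l" unfolding off_def
      by (rule sum_mono2) (use that in auto)
    finally show ?thesis .
  qed
  have disj: "set (B k) \<inter> set (B l) = {}" if "k < n" "l < n" "k \<noteq> l" for k l
  proof -
    have "\<tau> ! k < \<tau> ! l \<or> \<tau> ! l < \<tau> ! k"
      using that d\<tau> by (metis n_def nth_eq_iff_index_eq nat_neq_iff)
    then show ?thesis using step[of k l] step[of l k] that by (auto simp: sB)
  qed
  have top: "off k + length (bs ! k) \<le> N" if "k < n" for k
  proof -
    have "off k + length (bs ! k) = (\<Sum>m \<in> insert k {m. m < n \<and> \<tau> ! m < \<tau> ! k}. length (bs ! m))"
      by (simp add: off_def)
    also have "\<dots> \<le> N" unfolding N_def by (rule sum_mono2) (use that in auto)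
    finally show ?thesis .
  qed
  have set_eq: "set (inflate \<tau> bs) = (\<Union>k<n. set (B k))"
    by (simp add: infl atLeast0LessThan)
  have card: "card (set (inflate \<tau> bs)) = N"
  proof -
    have "card (\<Union>k<n. set (B k)) = (\<Sum>k<n. card (set (B k)))"
      by (rule card_UN_disjoint) (use disj in auto)
    also have "\<dots> = N" by (simp add: N_def sB)
    finally show ?thesis by (simp add: set_eq)
  qed
  have lenN: "length (inflate \<tau> bs) = N"
    by (simp add: infl length_concat comp_def B_def N_def interv_sum_list_conv_sum_set_nat
        atLeast0LessThan)
  have "distinct (inflate \<tau> bs)"
    by (rule card_distinct) (simp add: card lenN)
  moreover have "set (inflate \<tau> bs) = {1..N}"
  proof (rule card_subset_eq)
    show "set (inflate \<tau> bs) \<subseteq> {1..N}"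
      using top by (force simp: set_eq sB)
  qed (simp_all add: card)
  ultimately show ?thesis by (simp add: is_perm_iff lenN)
qed

lemma is_perm_inflate2:
  assumes "is_perm \<tau>" "is_perm \<phi>" "is_perm \<psi>"
  shows "is_perm (inflate2 \<tau> i j \<phi> \<psi>)"
  unfolding inflate2_def
proof (rule is_perm_inflate)
  have "is_perm [1]" by (auto simp: is_perm_iff)
  moreover have "set ((replicate (length \<tau>) [1])[i := \<phi>, j := \<psi>]) \<subseteq> {[1], \<phi>, \<psi>}"
    using set_update_subset_insert[of "replicate (length \<tau>) [1]" i \<phi>]
      set_update_subset_insert[of "(replicate (length \<tau>) [1])[i := \<phi>]" j \<psi>]
    by (auto dest!: subsetD)
  ultimately show "\<forall>b \<in> set ((replicate (length \<tau>) [1])[i := \<phi>, j := \<psi>]). is_perm b"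
    using assms by blast
qed (use assms in simp_all)

end

theory Submission
  imports Defs
begin

text \<open>
  For every set \<open>Q\<close> of at least two positions of \<open>\<pi>\<close>, the values \<open>mobius [1] \<alpha>\<close> sum to \<open>0\<close>
  over all \<open>\<alpha>\<close> that embed into \<open>Q\<close>. Hence \<open>mobius [1] \<pi> = 0\<close> as soon as some
  integer combination of indicators of embedding into such sets is \<open>1\<close> at \<open>\<pi>\<close> and vanishes at every
  smaller \<open>\<alpha>\<close> with \<open>mobius [1] \<alpha> \<noteq> 0\<close>.

  Let \<open>\<pi>\<close> have disjoint blocks \<open>\<phi> = 312\<close> and \<open>\<psi> = 23514\<close>, let \<open>u a b\<close> be the indicator of
  embedding into the permutation obtained from \<open>\<pi>\<close> by shrinking \<open>\<phi>\<close> to \<open>a\<close> and \<open>\<psi>\<close> to \<open>b\<close>, and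
  put \<open>g b = u 312 b - u 12 b - u 21 b + u 1 b\<close>. The combination \<open>g 23514 - g 2413\<close> works.
  If \<open>\<alpha>\<close> has no block 312, both terms vanish, because \<open>\<alpha>\<close> cannot have both a block 12 and a
  block 21. If \<open>\<alpha>\<close> has a block 312, it has no block 23514 (induction) and none of the patterns
  123, 2341, 1243, 2314 as a block, since these force \<open>mobius [1] \<alpha> = 0\<close>; every other proper
  pattern of 23514 is contained in 2413, so \<open>u a 23514 = u a 2413\<close>. The facts about the pairs
  (12, 21) and (312, 2314) and about 123 follow in the same way, the smaller pattern being
  1, 231 and 12 respectively.
\<close>

section \<open>Occurrences, embeddings into position sets, and blocks\<close>

definition occ :: "nat list \<Rightarrow> nat list \<Rightarrow> (nat \<Rightarrow> nat) \<Rightarrow> bool" where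
  "occ \<sigma> \<pi> g \<longleftrightarrow> (\<forall>i<length \<sigma>. g i < length \<pi>) \<and>
     (\<forall>i<length \<sigma>. \<forall>j<length \<sigma>. (g i < g j \<longleftrightarrow> i < j) \<and> (\<pi> ! g i < \<pi> ! g j \<longleftrightarrow> \<sigma> ! i < \<sigma> ! j))"

abbreviation img :: "nat list \<Rightarrow> (nat \<Rightarrow> nat) \<Rightarrow> nat set" where
  "img \<sigma> g \<equiv> g ` {..<length \<sigma>}"

text \<open>A position set \<open>Q\<close> stands for the permutation that \<open>\<pi>\<close>
  induces on it. Shrinking a block of \<open>\<pi>\<close> is then just deleting positions, with no
  renumbering of values.\<close>

definition embeds :: "nat list \<Rightarrow> nat list \<Rightarrow> nat set \<Rightarrow> bool" where
  "embeds \<sigma> \<pi> Q \<longleftrightarrow> (\<exists>g. occ \<sigma> \<pi> g \<and> img \<sigma> g \<subseteq> Q)"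

text \<open>With the ambient set \<open>Q\<close> as a parameter, these are the intervals of the
  permutation induced on \<open>Q\<close>. The empty set and single points of \<open>Q\<close> count
  as blocks.\<close>

definition block :: "nat list \<Rightarrow> nat set \<Rightarrow> nat set \<Rightarrow> bool" where
  "block \<pi> Q C \<longleftrightarrow> C \<subseteq> Q \<and>
     (\<forall>k \<in> Q - C. \<forall>x \<in> C. \<forall>y \<in> C. (k < x \<longleftrightarrow> k < y) \<and> (\<pi> ! k < \<pi> ! x \<longleftrightarrow> \<pi> ! k < \<pi> ! y))"

definition has_block :: "nat list \<Rightarrow> nat list \<Rightarrow> bool" where
  "has_block \<sigma> \<pi> \<longleftrightarrow> (\<exists>g. occ \<sigma> \<pi> g \<and> block \<pi> {..<length \<pi>} (img \<sigma> g))"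

lemma occ_less: "occ \<sigma> \<pi> g \<Longrightarrow> i < length \<sigma> \<Longrightarrow> g i < length \<pi>"
  and occ_pos: "occ \<sigma> \<pi> g \<Longrightarrow> i < length \<sigma> \<Longrightarrow> j < length \<sigma> \<Longrightarrow> g i < g j \<longleftrightarrow> i < j"
  and occ_val: "occ \<sigma> \<pi> g \<Longrightarrow> i < length \<sigma> \<Longrightarrow> j < length \<sigma> \<Longrightarrow>
    \<pi> ! g i < \<pi> ! g j \<longleftrightarrow> \<sigma> ! i < \<sigma> ! j"
  by (simp_all add: occ_def)

lemma occ_eq_iff: "occ \<sigma> \<pi> g \<Longrightarrow> i < length \<sigma> \<Longrightarrow> j < length \<sigma> \<Longrightarrow> g i = g j \<longleftrightarrow> i = j"
  using occ_pos[of \<sigma> \<pi> g i j] occ_pos[of \<sigma> \<pi> g j i] by (metis less_irrefl nat_neq_iff)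

lemma occ_inj_on: "occ \<sigma> \<pi> g \<Longrightarrow> inj_on g {..<length \<sigma>}"
  by (auto simp: inj_on_def occ_eq_iff)

lemma occ_subset: "occ \<sigma> \<pi> g \<Longrightarrow> img \<sigma> g \<subseteq> {..<length \<pi>}"
  by (auto simp: occ_less)

lemma card_img: "occ \<sigma> \<pi> g \<Longrightarrow> card (img \<sigma> g) = length \<sigma>"
  using card_image[OF occ_inj_on] by fastforce

lemma occ_comp: "occ \<sigma> \<rho> h \<Longrightarrow> occ \<rho> \<pi> g \<Longrightarrow> occ \<sigma> \<pi> (\<lambda>i. g (h i))"
  by (simp add: occ_def)

lemma occ_factor:
  assumes "occ \<rho> \<pi> g" "occ \<sigma> \<pi> f" "img \<sigma> f \<subseteq> img \<rho> g"
  obtains e where "occ \<sigma> \<rho> e" "\<forall>i<length \<sigma>. g (e i) = f i"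
proof -
  have "\<forall>i<length \<sigma>. \<exists>k<length \<rho>. g k = f i" using assms(3) by force
  then obtain e where e: "\<forall>i<length \<sigma>. e i < length \<rho> \<and> g (e i) = f i" by metis
  then have "occ \<sigma> \<rho> e"
    using assms(1,2) unfolding occ_def by metis
  with e show ?thesis using that by blast
qed

lemma embeds_mono: "embeds \<sigma> \<pi> Q \<Longrightarrow> Q \<subseteq> Q' \<Longrightarrow> embeds \<sigma> \<pi> Q'"
  by (auto simp: embeds_def)

lemma embeds_iff_occ:
  assumes "occ \<rho> \<pi> g"
  shows "embeds \<sigma> \<pi> (img \<rho> g) \<longleftrightarrow> (\<exists>h. occ \<sigma> \<rho> h)"
proof
  assume "embeds \<sigma> \<pi> (img \<rho> g)"
  then show "\<exists>h. occ \<sigma> \<rho> h"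
    using occ_factor[OF assms] unfolding embeds_def by metis
next
  assume "\<exists>h. occ \<sigma> \<rho> h"
  then obtain h where h: "occ \<sigma> \<rho> h" ..
  have "(\<lambda>i. g (h i)) ` {..<length \<sigma>} \<subseteq> img \<rho> g" using occ_less[OF h] by auto
  then show "embeds \<sigma> \<pi> (img \<rho> g)"
    unfolding embeds_def using occ_comp[OF h assms] by blast
qed

lemma perm_le_iff_occ: "\<sigma> \<preceq> \<pi> \<longleftrightarrow> is_perm \<sigma> \<and> is_perm \<pi> \<and> (\<exists>g. occ \<sigma> \<pi> g)"
proof -
  have "\<exists>g. occ \<sigma> \<pi> g" if s: "subseq xs \<pi>" and o: "order_iso xs \<sigma>" for xs
  proof -
    obtain N where "xs = nths \<pi> N" using s by (auto simp: subseq_conv_nths)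
    then have xs: "xs = map ((!) \<pi>) (nths [0..<length \<pi>] N)"
      by (metis map_nth nths_map)
    define ks where "ks = nths [0..<length \<pi>] N"
    have ks: "sorted ks" "distinct ks" "set ks \<subseteq> {..<length \<pi>}"
      using set_nths_subset[of "[0..<length \<pi>]" N] by (auto simp: ks_def sorted_nths)
    have mono: "ks ! i < ks ! j \<longleftrightarrow> i < j" if "i < length ks" "j < length ks" for i j
      using ks(1,2) that
      by (metis linorder_neqE_nat not_less_iff_gr_or_eq sorted_wrt_iff_nth_less
          strict_sorted_iff)
    have "xs ! i = \<pi> ! (ks ! i)" if "i < length ks" for i using xs that by (simp add: ks_def)
    moreover have "length xs = length ks" using xs by (simp add: ks_def)
    moreover have "\<forall>i<length ks. ks ! i < length \<pi>" using ks(3) nth_mem by blast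
    ultimately have "occ \<sigma> \<pi> ((!) ks)"
      using o mono unfolding occ_def order_iso_def by metis
    then show ?thesis by blast
  qed
  moreover have "\<exists>xs. subseq xs \<pi> \<and> order_iso xs \<sigma>" if g: "occ \<sigma> \<pi> g" for g
  proof (intro exI conjI)
    define ks where "ks = map g [0..<length \<sigma>]"
    have "sorted ks" "distinct ks"
      using g by (auto simp: ks_def sorted_iff_nth_mono distinct_map inj_on_def occ_eq_iff
          le_less occ_pos)
    then have "ks = filter (\<lambda>k. k \<in> set ks) [0..<length \<pi>]"
      by (intro sorted_distinct_set_unique sorted_wrt_filter) (auto simp: ks_def occ_less[OF g])
    then have "subseq ks [0..<length \<pi>]" by (metis subseq_filter_left)
    then show "subseq (map ((!) \<pi>) ks) \<pi>"
      by (metis subseq_map map_nth)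
    show "order_iso (map ((!) \<pi>) ks) \<sigma>"
      using g by (simp add: order_iso_def ks_def occ_val)
  qed
  ultimately show ?thesis unfolding perm_le_def by blast
qed

lemma ex_pattern:
  assumes \<pi>: "is_perm \<pi>" and Q: "Q \<subseteq> {..<length \<pi>}"
  obtains \<rho> g where "is_perm \<rho>" "occ \<rho> \<pi> g" "img \<rho> g = Q"
proof -
  have fin: "finite Q" using Q finite_subset by blast
  define ks where "ks = sorted_list_of_set Q"
  have ks: "set ks = Q" "sorted ks" "distinct ks" "length ks = card Q"
    using fin by (auto simp: ks_def)
  have d: "distinct \<pi>" using \<pi> by (simp add: is_perm_iff)
  \<comment> \<open>For \<open>k\<close> in \<open>Q\<close>, \<open>r k\<close> is the rank,
    counted from 1, of the value at \<open>k\<close> among the values at positions in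
    \<open>Q\<close>. This standardises the restriction of \<open>\<pi>\<close> to
    \<open>Q\<close>.\<close>
  define r where "r k = Suc (card {j \<in> Q. \<pi> ! j < \<pi> ! k})" for k
  have r: "r k < r l \<longleftrightarrow> \<pi> ! k < \<pi> ! l" if "k \<in> Q" "l \<in> Q" for k l
  proof -
    have le: "r l \<le> r k" if "\<pi> ! l \<le> \<pi> ! k" for k l
      unfolding r_def using that fin by (intro Suc_le_mono[THEN iffD2] card_mono) auto
    have "r k < r l" if "\<pi> ! k < \<pi> ! l"
      unfolding r_def using that fin \<open>k \<in> Q\<close>
      by (intro Suc_less_eq[THEN iffD2] psubset_card_mono) auto
    then show ?thesis using le[of l k] by linarith
  qed
  have inj: "inj_on r Q"
  proof (rule inj_onI)
    fix k l assume kl: "k \<in> Q" "l \<in> Q" "r k = r l"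
    then have "\<pi> ! k = \<pi> ! l" using r[of k l] r[of l k] by auto
    then show "k = l" using kl Q d by (metis lessThan_iff nth_eq_iff_index_eq subsetD)
  qed
  have sub: "r ` Q \<subseteq> {1..card Q}"
  proof
    fix v assume "v \<in> r ` Q"
    then obtain k where k: "k \<in> Q" "v = r k" by blast
    have "card {j \<in> Q. \<pi> ! j < \<pi> ! k} < card Q"
      using fin k by (intro psubset_card_mono) auto
    then show "v \<in> {1..card Q}" using k by (simp add: r_def)
  qed
  have "r ` Q = {1..card Q}"
    by (rule card_subset_eq) (use sub card_image[OF inj] in auto)
  then have "is_perm (map r ks)"
    using inj ks by (simp add: is_perm_iff distinct_map)
  moreover have mono: "ks ! i < ks ! j \<longleftrightarrow> i < j" if "i < length ks" "j < length ks" for i j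
    using ks(2,3) that
    by (metis linorder_neqE_nat not_less_iff_gr_or_eq sorted_wrt_iff_nth_less strict_sorted_iff)
  have "occ (map r ks) \<pi> ((!) ks)"
    using mono r ks(1) Q by (auto simp: occ_def subset_iff)
  moreover have "img (map r ks) ((!) ks) = Q"
    using ks(1) by (auto simp: set_conv_nth)
  ultimately show ?thesis using that by blast
qed

section \<open>Vanishing sums of the Moebius function and the weight criterion\<close>

lemma one_perm_le: "is_perm \<alpha> \<Longrightarrow> \<alpha> \<noteq> [] \<Longrightarrow> [1] \<preceq> \<alpha>"
  by (auto simp: perm_le_iff_occ occ_def is_perm_iff intro!: exI[of _ "\<lambda>_. 0"])

lemma finite_perm_le: "finite {\<tau>. \<tau> \<preceq> \<pi>}"
proof (rule finite_subset)
  show "{\<tau>. \<tau> \<preceq> \<pi>} \<subseteq> insert \<pi> {xs. set xs \<subseteq> {1..length \<pi>} \<and> length xs \<le> length \<pi>}"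
  proof
    fix \<tau> assume "\<tau> \<in> {\<tau>. \<tau> \<preceq> \<pi>}"
    then show "\<tau> \<in> insert \<pi> {xs. set xs \<subseteq> {1..length \<pi>} \<and> length xs \<le> length \<pi>}"
      using perm_less_length[of \<tau> \<pi>] by (auto simp: perm_less_def perm_le_def is_perm_iff)
  qed
  show "finite (insert \<pi> {xs. set xs \<subseteq> {1..length \<pi>} \<and> length xs \<le> length \<pi>})"
    by (simp add: finite_lists_length_le)
qed

text \<open>This is the recursion for \<open>mobius [1] \<rho>\<close> with all terms on one side.
  Length at least 2 excludes \<open>\<rho> = [1]\<close>, where the sum would be 1.\<close>

lemma sum_mobius_perm_le:
  assumes "is_perm \<rho>" "2 \<le> length \<rho>"
  shows "(\<Sum>\<alpha> | \<alpha> \<preceq> \<rho>. mobius [1] \<alpha>) = 0"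
proof -
  have ne: "\<rho> \<noteq> [1]" and "\<rho> \<noteq> []" using assms(2) by auto
  then have le: "[1] \<preceq> \<rho>" using assms(1) one_perm_le by blast
  define S where "S = {\<tau>. [1] \<preceq> \<tau> \<and> \<tau> \<prec> \<rho>}"
  have fin: "finite S" unfolding S_def by (rule finite_perm_less)
  have "\<rho> \<preceq> \<rho>" using assms by (auto simp: perm_le_iff_occ occ_def intro!: exI[of _ id])
  then have sub: "insert \<rho> S \<subseteq> {\<alpha>. \<alpha> \<preceq> \<rho>}" by (auto simp: S_def perm_less_def)
  have "(\<Sum>\<alpha> | \<alpha> \<preceq> \<rho>. mobius [1] \<alpha>) = (\<Sum>\<alpha> \<in> insert \<rho> S. mobius [1] \<alpha>)"
  proof (rule sum.mono_neutral_right[OF finite_perm_le sub], rule ballI)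
    fix \<alpha> assume "\<alpha> \<in> {\<alpha>. \<alpha> \<preceq> \<rho>} - insert \<rho> S"
    \<comment> \<open>Only the empty permutation remains here; its value is 0 by the first clause of
      \<open>mobius\<close>.\<close>
    then have "\<not> [1] \<preceq> \<alpha>" by (auto simp: S_def perm_less_def)
    then show "mobius [1] \<alpha> = 0" by (simp add: mobius.simps)
  qed
  also have "\<dots> = mobius [1] \<rho> + (\<Sum>\<alpha>\<in>S. mobius [1] \<alpha>)"
    using fin by (intro sum.insert) (auto simp: S_def perm_less_def)
  also have "\<dots> = 0" using ne le by (subst mobius.simps) (simp add: S_def)
  finally show ?thesis .
qed

lemma sum_mobius_embeds:
  assumes \<pi>: "is_perm \<pi>" and Q: "Q \<subseteq> {..<length \<pi>}" "2 \<le> card Q"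
  shows "(\<Sum>\<alpha> | \<alpha> \<preceq> \<pi>. mobius [1] \<alpha> * of_bool (embeds \<alpha> \<pi> Q)) = 0"
proof -
  obtain \<rho> g where g: "is_perm \<rho>" "occ \<rho> \<pi> g" "img \<rho> g = Q"
    using ex_pattern[OF \<pi> Q(1)] .
  have "{\<alpha>. \<alpha> \<preceq> \<pi> \<and> embeds \<alpha> \<pi> Q} = {\<alpha>. \<alpha> \<preceq> \<rho>}"
    using g(1) \<pi> embeds_iff_occ[OF g(2)] by (force simp: perm_le_iff_occ g(3) embeds_def)
  moreover have "(\<Sum>\<alpha> | \<alpha> \<preceq> \<pi>. mobius [1] \<alpha> * of_bool (embeds \<alpha> \<pi> Q)) =
      (\<Sum>\<alpha> | \<alpha> \<preceq> \<pi> \<and> embeds \<alpha> \<pi> Q. mobius [1] \<alpha>)"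
    using finite_perm_le[of \<pi>] by (intro sum.mono_neutral_cong_right) auto
  moreover have "2 \<le> length \<rho>" using card_img[OF g(2)] g(3) Q(2) by simp
  ultimately show ?thesis using sum_mobius_perm_le[OF g(1)] by simp
qed

lemma mobius_eq_0_if_weights:
  assumes \<pi>: "is_perm \<pi>"
    and Q: "\<And>c Q. (c, Q) \<in> set cs \<Longrightarrow> Q \<subseteq> {..<length \<pi>} \<and> 2 \<le> card Q"
    and zero: "\<And>\<alpha>. \<alpha> \<prec> \<pi> \<Longrightarrow> mobius [1] \<alpha> \<noteq> 0 \<Longrightarrow>
      (\<Sum>(c, Q)\<leftarrow>cs. c * of_bool (embeds \<alpha> \<pi> Q)) = (0 :: int)"
    and one: "(\<Sum>(c, Q)\<leftarrow>cs. c * of_bool (embeds \<pi> \<pi> Q)) = (1 :: int)"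
  shows "mobius [1] \<pi> = 0"
proof -
  define w :: "nat list \<Rightarrow> int" where "w \<alpha> = (\<Sum>(c, Q)\<leftarrow>cs. c * of_bool (embeds \<alpha> \<pi> Q))" for \<alpha>
  have "(\<Sum>\<alpha> | \<alpha> \<preceq> \<pi>. mobius [1] \<alpha> * (\<Sum>(c, Q)\<leftarrow>ds. c * of_bool (embeds \<alpha> \<pi> Q))) = 0"
    if "set ds \<subseteq> set cs" for ds
    using that
  proof (induction ds)
    case (Cons d ds)
    obtain c Q where d: "d = (c, Q)" by fastforce
    have "(\<Sum>\<alpha> | \<alpha> \<preceq> \<pi>. mobius [1] \<alpha> * (c * of_bool (embeds \<alpha> \<pi> Q))) =
        c * (\<Sum>\<alpha> | \<alpha> \<preceq> \<pi>. mobius [1] \<alpha> * of_bool (embeds \<alpha> \<pi> Q))"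
      by (simp add: sum_distrib_left mult.left_commute del: sum_mult_of_bool_eq)
    also have "\<dots> = 0" using sum_mobius_embeds[OF \<pi>] Q[of c Q] Cons.prems by (simp add: d)
    finally show ?case using Cons
      by (simp add: d distrib_left sum.distrib del: sum_mult_of_bool_eq)
  qed simp
  then have "0 = (\<Sum>\<alpha> | \<alpha> \<preceq> \<pi>. mobius [1] \<alpha> * w \<alpha>)" by (simp add: w_def)
  also have "\<dots> = (\<Sum>\<alpha> \<in> {\<pi>}. mobius [1] \<alpha> * w \<alpha>)"
  proof (rule sum.mono_neutral_right[OF finite_perm_le])
    show "{\<pi>} \<subseteq> {\<alpha>. \<alpha> \<preceq> \<pi>}"
      using \<pi> by (auto simp: perm_le_iff_occ occ_def intro!: exI[of _ id])
    show "\<forall>\<alpha> \<in> {\<alpha>. \<alpha> \<preceq> \<pi>} - {\<pi>}. mobius [1] \<alpha> * w \<alpha> = 0"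
      using zero by (auto simp: w_def perm_less_def)
  qed
  finally show ?thesis using one by (simp add: w_def)
qed

section \<open>Blocks of subpermutations, and moving embeddings inside a block\<close>

lemma has_blockI:
  assumes g: "occ \<alpha> \<pi> g" and f: "occ \<sigma> \<pi> f" and sub: "img \<sigma> f \<subseteq> img \<alpha> g"
    and b: "block \<pi> (img \<alpha> g) (img \<sigma> f)"
  shows "has_block \<sigma> \<alpha>"
proof -
  obtain e where e: "occ \<sigma> \<alpha> e" "\<forall>i<length \<sigma>. g (e i) = f i" using occ_factor[OF g f sub] .
  have "block \<alpha> {..<length \<alpha>} (img \<sigma> e)"
    unfolding block_def
  proof (intro conjI ballI)
    fix k x y assume k: "k \<in> {..<length \<alpha>} - img \<sigma> e" and x: "x \<in> img \<sigma> e" and y: "y \<in> img \<sigma> e"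
    \<comment> \<open>As \<open>g\<close> is injective, positions of \<open>\<alpha>\<close> outside
      the pulled-back block go to positions outside the block in \<open>\<pi>\<close>, where the
      comparisons are known.\<close>
    have "g k \<notin> img \<sigma> f"
    proof
      assume "g k \<in> img \<sigma> f"
      then obtain i where "i < length \<sigma>" "g k = g (e i)" using e(2) by auto
      then show False using k occ_less[OF e(1)] by (auto simp: occ_eq_iff[OF g])
    qed
    then have "(g k < g x \<longleftrightarrow> g k < g y) \<and> (\<pi> ! g k < \<pi> ! g x \<longleftrightarrow> \<pi> ! g k < \<pi> ! g y)"
    proof -
      have "g x \<in> img \<sigma> f" "g y \<in> img \<sigma> f" using x y e(2) by auto
      moreover have "g k \<in> img \<alpha> g" using k by auto
      ultimately show ?thesis using b \<open>g k \<notin> img \<sigma> f\<close> unfolding block_def by blast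
    qed
    moreover have "k < length \<alpha>" "x < length \<alpha>" "y < length \<alpha>"
      using k x y occ_less[OF e(1)] by auto
    ultimately show "k < x \<longleftrightarrow> k < y" "\<alpha> ! k < \<alpha> ! x \<longleftrightarrow> \<alpha> ! k < \<alpha> ! y"
      using occ_pos[OF g] occ_val[OF g] by simp_all
  qed (use occ_subset[OF e(1)] in auto)
  with e(1) show ?thesis unfolding has_block_def by blast
qed

text \<open>A position outside the copy of \<open>\<sigma>\<close> is either inside the copy of
  \<open>\<psi>\<close>, where the first block decides, or outside it, where the second
  does.\<close>

lemma has_block_trans:
  assumes "has_block \<sigma> \<psi>" "has_block \<psi> \<pi>"
  shows "has_block \<sigma> \<pi>"
proof -
  obtain h where h: "occ \<sigma> \<psi> h" "block \<psi> {..<length \<psi>} (img \<sigma> h)"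
    using assms(1) by (auto simp: has_block_def)
  obtain g where g: "occ \<psi> \<pi> g" "block \<pi> {..<length \<pi>} (img \<psi> g)"
    using assms(2) by (auto simp: has_block_def)
  have "block \<pi> {..<length \<pi>} ((\<lambda>i. g (h i)) ` {..<length \<sigma>})"
    unfolding block_def
  proof (intro conjI ballI)
    fix k x y
    assume k: "k \<in> {..<length \<pi>} - (\<lambda>i. g (h i)) ` {..<length \<sigma>}"
      and "x \<in> (\<lambda>i. g (h i)) ` {..<length \<sigma>}" "y \<in> (\<lambda>i. g (h i)) ` {..<length \<sigma>}"
    then obtain i j where ij: "i < length \<sigma>" "j < length \<sigma>" "x = g (h i)" "y = g (h j)" by auto
    note l = occ_less[OF h(1) ij(1)] occ_less[OF h(1) ij(2)]
    have "(k < x \<longleftrightarrow> k < y) \<and> (\<pi> ! k < \<pi> ! x \<longleftrightarrow> \<pi> ! k < \<pi> ! y)"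
    proof (cases "k \<in> img \<psi> g")
      case True
      then obtain k' where k': "k' < length \<psi>" "k = g k'" by auto
      then have "k' \<notin> img \<sigma> h" using k by auto
      then show ?thesis
      proof -
        have "h i \<in> img \<sigma> h" "h j \<in> img \<sigma> h" using ij by auto
        then have "(k' < h i \<longleftrightarrow> k' < h j) \<and> (\<psi> ! k' < \<psi> ! h i \<longleftrightarrow> \<psi> ! k' < \<psi> ! h j)"
          using h(2) k'(1) \<open>k' \<notin> img \<sigma> h\<close> unfolding block_def by blast
        then show ?thesis
          using k' ij(3,4) l by (simp add: occ_pos[OF g(1)] occ_val[OF g(1)])
      qed
    next
      case False
      moreover have "x \<in> img \<psi> g" "y \<in> img \<psi> g" using ij l by auto
      ultimately show ?thesis using g(2) k unfolding block_def by blast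
    qed
    then show "k < x \<longleftrightarrow> k < y" "\<pi> ! k < \<pi> ! x \<longleftrightarrow> \<pi> ! k < \<pi> ! y" by auto
  qed (use occ_less[OF g(1)] occ_less[OF h(1)] in auto)
  then show ?thesis unfolding has_block_def using occ_comp[OF h(1) g(1)] by blast
qed

text \<open>Points of \<open>\<alpha>\<close> inside the block are rerouted from \<open>h\<close> to
  \<open>h'\<close>. Comparisons among them survive because both are occurrences of
  \<open>\<beta>\<close>; comparisons with the rest survive because no outside point distinguishes
  two points of a block.\<close>

lemma occ_replace:
  assumes \<pi>: "is_perm \<pi>"
    and e: "occ \<psi> \<pi> e" and b: "block \<pi> {..<length \<pi>} (img \<psi> e)" and g: "occ \<alpha> \<pi> g"
    and h: "occ \<beta> \<psi> h" "occ \<beta> \<psi> h'" and sub: "img \<alpha> g \<inter> img \<psi> e \<subseteq> e ` img \<beta> h"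
  shows "embeds \<alpha> \<pi> ((img \<alpha> g - img \<psi> e) \<union> e ` img \<beta> h')"
proof -
  have d: "distinct \<pi>" using \<pi> by (simp add: is_perm_iff)
  have "\<forall>i. \<exists>k. i < length \<alpha> \<and> g i \<in> img \<psi> e \<longrightarrow> k < length \<beta> \<and> g i = e (h k)"
    using sub by blast
  then obtain k where k: "\<And>i. i < length \<alpha> \<Longrightarrow> g i \<in> img \<psi> e \<Longrightarrow> k i < length \<beta> \<and> g i = e (h (k i))"
    by metis
  define g' where "g' i = (if g i \<in> img \<psi> e then e (h' (k i)) else g i)" for i
  have eh: "occ \<beta> \<pi> (\<lambda>i. e (h i))" and eh': "occ \<beta> \<pi> (\<lambda>i. e (h' i))"
    using occ_comp[OF _ e] h by auto
  have in_B: "e (h i) \<in> img \<psi> e" "e (h' i) \<in> img \<psi> e" if "i < length \<beta>" for i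
    using occ_less[OF h(1) that] occ_less[OF h(2) that] by auto
  have outside: "(x < y \<longleftrightarrow> x < y') \<and> (y < x \<longleftrightarrow> y' < x) \<and>
      (\<pi> ! x < \<pi> ! y \<longleftrightarrow> \<pi> ! x < \<pi> ! y') \<and> (\<pi> ! y < \<pi> ! x \<longleftrightarrow> \<pi> ! y' < \<pi> ! x)"
    if "x < length \<pi>" "x \<notin> img \<psi> e" "y \<in> img \<psi> e" "y' \<in> img \<psi> e" for x y y'
  proof -
    have "(x < y \<longleftrightarrow> x < y') \<and> (\<pi> ! x < \<pi> ! y \<longleftrightarrow> \<pi> ! x < \<pi> ! y')"
      using b that unfolding block_def by blast
    moreover have "x \<noteq> y" "x \<noteq> y'" using that by auto
    moreover have "y < length \<pi>" "y' < length \<pi>" using that occ_subset[OF e] by auto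
    \<comment> \<open>In \<open>block\<close> the outside point always stands on the left of a
      comparison. The reversed comparisons follow because the positions and, by distinctness, the
      values differ.\<close>
    ultimately show ?thesis using that(1) d by (metis linorder_neqE_nat nth_eq_iff_index_eq order.asym)
  qed
  have "occ \<alpha> \<pi> g'"
    unfolding occ_def
  proof (intro conjI allI impI)
    fix i assume i: "i < length \<alpha>"
    then show "g' i < length \<pi>"
      using k[OF i] occ_less[OF g i] occ_less[OF eh'] by (auto simp: g'_def)
    fix j assume j: "j < length \<alpha>"
    consider "g i \<in> img \<psi> e" "g j \<in> img \<psi> e" | "g i \<in> img \<psi> e" "g j \<notin> img \<psi> e"
      | "g i \<notin> img \<psi> e" "g j \<in> img \<psi> e" | "g i \<notin> img \<psi> e" "g j \<notin> img \<psi> e" by blast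
    then have "(g' i < g' j \<longleftrightarrow> g i < g j) \<and> (\<pi> ! g' i < \<pi> ! g' j \<longleftrightarrow> \<pi> ! g i < \<pi> ! g j)"
    proof cases
      case 1
      then show ?thesis
        using k[OF i] k[OF j] occ_pos[OF eh] occ_pos[OF eh'] occ_val[OF eh] occ_val[OF eh']
        by (simp add: g'_def)
    next
      case 2
      then show ?thesis
        using outside[of "g j" "g i" "e (h' (k i))"] k[OF i] occ_less[OF g j] in_B(2)
        by (simp add: g'_def)
    next
      case 3
      then show ?thesis
        using outside[of "g i" "g j" "e (h' (k j))"] k[OF j] occ_less[OF g i] in_B(2)
        by (simp add: g'_def)
    next
      case 4
      then show ?thesis by (simp add: g'_def)
    qed
    then show "g' i < g' j \<longleftrightarrow> i < j" "\<pi> ! g' i < \<pi> ! g' j \<longleftrightarrow> \<alpha> ! i < \<alpha> ! j"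
      using occ_pos[OF g i j] occ_val[OF g i j] by auto
  qed
  moreover have "img \<alpha> g' \<subseteq> (img \<alpha> g - img \<psi> e) \<union> e ` img \<beta> h'"
    using k by (auto simp: g'_def)
  ultimately show ?thesis unfolding embeds_def by blast
qed

text \<open>
  In any block \<open>\<psi>\<close>, an embedding that meets the block in \<open>J\<close> can be moved so as to meet it inside \<open>L\<close>.
\<close>

definition reduces :: "nat list \<Rightarrow> nat set \<Rightarrow> nat set \<Rightarrow> bool" where
  "reduces \<psi> J L \<longleftrightarrow> (\<exists>\<beta> h h'. occ \<beta> \<psi> h \<and> J \<subseteq> img \<beta> h \<and> occ \<beta> \<psi> h' \<and> img \<beta> h' \<subseteq> L)"

lemma img_nth: "length js = length \<beta> \<Longrightarrow> img \<beta> ((!) js) = set js"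
  by (auto simp: set_conv_nth)

text \<open>Occurrences are given as position lists read through \<open>(!)\<close>, so concrete
  instances become finitely many comparisons. As \<open>js\<close> only has to cover
  \<open>J\<close>, one choice serves all subsets of a set.\<close>

lemma reducesI:
  assumes "occ \<beta> \<psi> ((!) js)" "occ \<beta> \<psi> ((!) ks)" "length js = length \<beta>" "length ks = length \<beta>"
    "J \<subseteq> set js" "set ks \<subseteq> L"
  shows "reduces \<psi> J L"
  unfolding reduces_def using assms by (metis img_nth)

text \<open>\<open>J\<close> is the set of places in \<open>\<psi>\<close> used by one embedding.
  Its pattern is a block of \<open>\<alpha>\<close>, since a block meets the image of an embedding
  in a block of that image.\<close>

lemma block_cases:
  assumes d: "is_perm \<pi>" and e: "occ \<psi> \<pi> e" and b: "block \<pi> {..<length \<pi>} (img \<psi> e)"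
    and Q: "Q \<inter> img \<psi> e = {}" and K: "K \<subseteq> {..<length \<psi>}" and emb: "embeds \<alpha> \<pi> (Q \<union> e ` K)"
  obtains J where "J \<subseteq> K" "\<And>\<beta> h. occ \<beta> \<psi> h \<Longrightarrow> img \<beta> h = J \<Longrightarrow> has_block \<beta> \<alpha>"
    "\<And>L. reduces \<psi> J L \<Longrightarrow> embeds \<alpha> \<pi> (Q \<union> e ` L)"
proof -
  obtain g where g: "occ \<alpha> \<pi> g" "img \<alpha> g \<subseteq> Q \<union> e ` K" using emb by (auto simp: embeds_def)
  define J where "J = {j \<in> {..<length \<psi>}. e j \<in> img \<alpha> g}"
  have "G \<inter> e ` N = e ` {j \<in> N. e j \<in> G}" for G N by blast
  then have J: "img \<alpha> g \<inter> img \<psi> e = e ` J" by (simp only: J_def)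
  have "J \<subseteq> K"
  proof
    fix j assume j: "j \<in> J"
    then have "e j \<in> e ` K" using g(2) Q by (auto simp: J_def)
    then show "j \<in> K" using j K occ_eq_iff[OF e] by (auto simp: J_def)
  qed
  moreover have "has_block \<beta> \<alpha>" if h: "occ \<beta> \<psi> h" "img \<beta> h = J" for \<beta> h
  proof (rule has_blockI[OF g(1) occ_comp[OF h(1) e]])
    have im: "(\<lambda>i. e (h i)) ` {..<length \<beta>} = img \<alpha> g \<inter> img \<psi> e"
      unfolding J h(2)[symmetric] by (simp add: image_image)
    show "(\<lambda>i. e (h i)) ` {..<length \<beta>} \<subseteq> img \<alpha> g" unfolding im by blast
    show "block \<pi> (img \<alpha> g) ((\<lambda>i. e (h i)) ` {..<length \<beta>})"
      unfolding im using b occ_subset[OF g(1)] unfolding block_def by blast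
  qed
  moreover have "embeds \<alpha> \<pi> (Q \<union> e ` L)" if r: "reduces \<psi> J L" for L
  proof -
    obtain \<beta> h h' where h: "occ \<beta> \<psi> h" "J \<subseteq> img \<beta> h" "occ \<beta> \<psi> h'" "img \<beta> h' \<subseteq> L"
      using r unfolding reduces_def by blast
    have "embeds \<alpha> \<pi> ((img \<alpha> g - img \<psi> e) \<union> e ` img \<beta> h')"
      by (rule occ_replace[OF d e b g(1) h(1,3)]) (use h(2) J in auto)
    moreover have "e ` K \<subseteq> img \<psi> e" "e ` img \<beta> h' \<subseteq> e ` L" using K h(4) by blast+
    then have "(img \<alpha> g - img \<psi> e) \<union> e ` img \<beta> h' \<subseteq> Q \<union> e ` L"
    proof -
      have "G - B \<union> X \<subseteq> Q \<union> Y" if "G \<subseteq> Q \<union> Z" "Z \<subseteq> B" "X \<subseteq> Y" for G B X Y Z :: "nat set"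
        using that by blast
      then show ?thesis using g(2) \<open>e ` K \<subseteq> img \<psi> e\<close> \<open>e ` img \<beta> h' \<subseteq> e ` L\<close> by this
    qed
    ultimately show ?thesis by (rule embeds_mono)
  qed
  ultimately show ?thesis using that by blast
qed

section \<open>Vanishing for permutations with two disjoint blocks\<close>

text \<open>
  On nonzero \<open>\<alpha>\<close> without a block \<open>\<phi>\<close>, embedding through a block \<open>\<phi>\<close> is the combination \<open>cs\<close> of
  embeddings through proper parts of that block.
\<close>

definition resolves :: "nat list \<Rightarrow> (int \<times> nat set) list \<Rightarrow> bool" where
  "resolves \<phi> cs \<longleftrightarrow> (\<forall>(c, K) \<in> set cs. K \<noteq> {} \<and> K \<subset> {..<length \<phi>}) \<and>
     (\<forall>\<pi> e Q \<alpha>. is_perm \<pi> \<longrightarrow> occ \<phi> \<pi> e \<longrightarrow> block \<pi> {..<length \<pi>} (img \<phi> e) \<longrightarrow>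
        Q \<inter> img \<phi> e = {} \<longrightarrow> is_perm \<alpha> \<longrightarrow> mobius [1] \<alpha> \<noteq> 0 \<longrightarrow> \<not> has_block \<phi> \<alpha> \<longrightarrow>
        of_bool (embeds \<alpha> \<pi> (Q \<union> img \<phi> e)) = (\<Sum>(c, K)\<leftarrow>cs. c * of_bool (embeds \<alpha> \<pi> (Q \<union> e ` K))))"

lemma embeds_self_iff:
  assumes "Q \<subseteq> {..<length \<pi>}"
  shows "embeds \<pi> \<pi> Q \<longleftrightarrow> Q = {..<length \<pi>}"
proof
  assume "embeds \<pi> \<pi> Q"
  then obtain g where g: "occ \<pi> \<pi> g" "img \<pi> g \<subseteq> Q" by (auto simp: embeds_def)
  have "img \<pi> g = {..<length \<pi>}"
    by (rule card_subset_eq) (use card_img[OF g(1)] g(2) assms in auto)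
  then show "Q = {..<length \<pi>}" using g assms by blast
next
  assume "Q = {..<length \<pi>}"
  then show "embeds \<pi> \<pi> Q" by (auto simp: embeds_def occ_def intro!: exI[of _ id])
qed

definition blocks_disjoint :: "nat list \<Rightarrow> nat list \<Rightarrow> bool" where
  "blocks_disjoint \<phi> \<psi> \<longleftrightarrow> (\<forall>\<pi> e f. is_perm \<pi> \<longrightarrow>
     occ \<phi> \<pi> e \<longrightarrow> block \<pi> {..<length \<pi>} (img \<phi> e) \<longrightarrow>
     occ \<psi> \<pi> f \<longrightarrow> block \<pi> {..<length \<pi>} (img \<psi> f) \<longrightarrow> img \<phi> e \<inter> img \<psi> f = {})"

text \<open>
  The indicators are those of \<open>\<pi>\<close> with its block \<open>\<psi>\<close> kept or shrunk to \<open>L\<close>, and its block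
  \<open>\<phi>\<close> kept or shrunk according to \<open>cs\<close>. They cancel along \<open>cs\<close> if \<open>\<alpha>\<close> has no block \<open>\<phi>\<close>, and
  between \<open>\<psi>\<close> and \<open>L\<close> otherwise.
\<close>

lemma mobius_eq_0_block_pair:
  assumes res: "resolves \<phi> cs" and disj: "blocks_disjoint \<phi> \<psi>" and \<phi>: "\<phi> \<noteq> []"
    and L: "L \<noteq> {}" "L \<subset> {..<length \<psi>}"
    and red: "\<And>\<alpha> J. is_perm \<alpha> \<Longrightarrow> mobius [1] \<alpha> \<noteq> 0 \<Longrightarrow> has_block \<phi> \<alpha> \<Longrightarrow> J \<subset> {..<length \<psi>} \<Longrightarrow>
      (\<And>\<beta> h. occ \<beta> \<psi> h \<Longrightarrow> img \<beta> h = J \<Longrightarrow> has_block \<beta> \<alpha>) \<Longrightarrow> reduces \<psi> J L"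
    and \<pi>: "is_perm \<pi>" "has_block \<phi> \<pi>" "has_block \<psi> \<pi>"
  shows "mobius [1] \<pi> = 0"
  using \<pi>
proof (induction "length \<pi>" arbitrary: \<pi> rule: less_induct)
  case less
  note perm = less.prems(1)
  obtain e where e: "occ \<phi> \<pi> e" "block \<pi> {..<length \<pi>} (img \<phi> e)"
    using less.prems(2) by (auto simp: has_block_def)
  obtain f where f: "occ \<psi> \<pi> f" "block \<pi> {..<length \<pi>} (img \<psi> f)"
    using less.prems(3) by (auto simp: has_block_def)
  define A where "A = img \<phi> e"
  define B where "B = img \<psi> f"
  define R where "R = {..<length \<pi>} - A - B"
  have AB: "A \<inter> B = {}" using disj perm e f unfolding blocks_disjoint_def A_def B_def by blast
  have sub: "A \<subseteq> {..<length \<pi>}" "B \<subseteq> {..<length \<pi>}"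
    using occ_subset[OF e(1)] occ_subset[OF f(1)] by (auto simp: A_def B_def)
  have fL: "f ` L \<subseteq> B" "f ` L \<noteq> B" "f ` L \<noteq> {}"
    using L inj_on_image_eq_iff[OF occ_inj_on[OF f(1)], of L "{..<length \<psi>}"]
    by (auto simp: B_def)
  have eK: "e ` K \<subseteq> A" "e ` K \<noteq> A" "e ` K \<noteq> {}" if "(c, K) \<in> set cs" for c K
  proof -
    have K: "K \<noteq> {}" "K \<subset> {..<length \<phi>}" using res that by (auto simp: resolves_def)
    then show "e ` K \<subseteq> A" "e ` K \<noteq> A" "e ` K \<noteq> {}"
      using inj_on_image_eq_iff[OF occ_inj_on[OF e(1)], of K "{..<length \<phi>}"]
      by (auto simp: A_def)
  qed
  have A_ne: "A \<noteq> {}" using \<phi> by (auto simp: A_def)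
  have B_ne: "B \<noteq> {}" using fL by blast
  \<comment> \<open>Every set used below keeps a point of \<open>A\<close> and a point of
    \<open>B\<close>. These are distinct, which gives the two positions that the vanishing sums
    require.\<close>
  have ok: "R \<union> A' \<union> B' \<subseteq> {..<length \<pi>} \<and> 2 \<le> card (R \<union> A' \<union> B')"
    if A': "A' \<subseteq> A" "A' \<noteq> {}" and B': "B' \<subseteq> B" "B' \<noteq> {}" for A' B'
  proof -
    obtain a b where ab: "a \<in> A'" "b \<in> B'" using A' B' by blast
    have s: "R \<union> A' \<union> B' \<subseteq> {..<length \<pi>}" using A' B' sub by (auto simp: R_def)
    have "card {a, b} \<le> card (R \<union> A' \<union> B')"
      using ab by (intro card_mono finite_subset[OF s]) auto
    moreover have "a \<noteq> b" using ab A' B' AB by blast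
    ultimately show ?thesis using s by simp
  qed
  have self: "embeds \<pi> \<pi> (R \<union> A' \<union> B') \<longleftrightarrow> A' = A \<and> B' = B" if "A' \<subseteq> A" "B' \<subseteq> B" for A' B'
  proof -
    have "R \<union> A' \<union> B' \<subseteq> {..<length \<pi>}" using that sub by (auto simp: R_def)
    then have "embeds \<pi> \<pi> (R \<union> A' \<union> B') \<longleftrightarrow> R \<union> A' \<union> B' = {..<length \<pi>}"
      by (rule embeds_self_iff)
    moreover have "(R \<union> A' \<union> B') \<inter> A = A'" "(R \<union> A' \<union> B') \<inter> B = B'"
      using that AB by (auto simp: R_def)
    moreover have "R \<union> A \<union> B = {..<length \<pi>}" using sub by (auto simp: R_def)
    ultimately show ?thesis using sub by (metis inf.absorb2)
  qed
  \<comment> \<open>The expanded product of two formal differences: \<open>A\<close> minus the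
    combination \<open>cs\<close> of its parts, and \<open>B\<close> minus its part given by
    \<open>L\<close>.\<close>
  define ws where "ws = (1, R \<union> A \<union> B) # (- 1, R \<union> A \<union> f ` L) #
    map (\<lambda>(c, K). (- c, R \<union> e ` K \<union> B)) cs @ map (\<lambda>(c, K). (c, R \<union> e ` K \<union> f ` L)) cs"
  have ws: "(\<Sum>(c, Q)\<leftarrow>ws. c * of_bool (embeds \<alpha> \<pi> Q)) =
      (of_bool (embeds \<alpha> \<pi> (R \<union> A \<union> B)) - (\<Sum>(c, K)\<leftarrow>cs. c * of_bool (embeds \<alpha> \<pi> (R \<union> e ` K \<union> B)))) -
      (of_bool (embeds \<alpha> \<pi> (R \<union> A \<union> f ` L)) -
        (\<Sum>(c, K)\<leftarrow>cs. c * of_bool (embeds \<alpha> \<pi> (R \<union> e ` K \<union> f ` L))))" for \<alpha>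
    by (simp add: ws_def comp_def case_prod_unfold uminus_sum_list_map)
  show ?case
  proof (rule mobius_eq_0_if_weights[OF perm, of ws])
    fix c Q assume "(c, Q) \<in> set ws"
    then show "Q \<subseteq> {..<length \<pi>} \<and> 2 \<le> card Q"
    proof -
      from \<open>(c, Q) \<in> set ws\<close> consider "Q = R \<union> A \<union> B" | "Q = R \<union> A \<union> f ` L"
        | d K where "(d, K) \<in> set cs" "Q = R \<union> e ` K \<union> B"
        | d K where "(d, K) \<in> set cs" "Q = R \<union> e ` K \<union> f ` L"
        unfolding ws_def by auto
      then show ?thesis
      proof cases
        case 1
        show ?thesis unfolding 1 by (rule ok[OF order.refl A_ne order.refl B_ne])
      next
        case 2
        show ?thesis unfolding 2 by (rule ok[OF order.refl A_ne fL(1,3)])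
      next
        case 3
        show ?thesis unfolding 3(2) by (rule ok[OF eK(1,3)[OF 3(1)] order.refl B_ne])
      next
        case 4
        show ?thesis unfolding 4(2) by (rule ok[OF eK(1,3)[OF 4(1)] fL(1,3)])
      qed
    qed
  next
    fix \<alpha> assume \<alpha>: "\<alpha> \<prec> \<pi>" and nz: "mobius [1] \<alpha> \<noteq> 0"
    have p\<alpha>: "is_perm \<alpha>" using \<alpha> by (simp add: perm_less_def perm_le_def)
    show "(\<Sum>(c, Q)\<leftarrow>ws. c * of_bool (embeds \<alpha> \<pi> Q)) = 0"
    proof (cases "has_block \<phi> \<alpha>")
      case False
      have "of_bool (embeds \<alpha> \<pi> (R \<union> A \<union> B')) =
          (\<Sum>(c, K)\<leftarrow>cs. c * of_bool (embeds \<alpha> \<pi> (R \<union> e ` K \<union> B')))" if "B' \<subseteq> B" for B'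
      proof -
        have "(R \<union> B') \<inter> img \<phi> e = {}" using that AB by (auto simp: R_def A_def)
        then have "of_bool (embeds \<alpha> \<pi> (R \<union> B' \<union> A)) =
          (\<Sum>(c, K)\<leftarrow>cs. c * of_bool (embeds \<alpha> \<pi> (R \<union> B' \<union> e ` K)))"
          using res perm e p\<alpha> nz False unfolding resolves_def A_def by blast
        then show ?thesis by (simp add: Un_ac)
      qed
      then show ?thesis using fL(1) unfolding ws by simp
    next
      case True
      have "embeds \<alpha> \<pi> (R \<union> A' \<union> B) \<longleftrightarrow> embeds \<alpha> \<pi> (R \<union> A' \<union> f ` L)" if A': "A' \<subseteq> A" for A'
      proof
        assume emb: "embeds \<alpha> \<pi> (R \<union> A' \<union> B)"
        have "(R \<union> A') \<inter> img \<psi> f = {}" using A' AB by (auto simp: R_def B_def)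
        then obtain J where J: "J \<subseteq> {..<length \<psi>}"
            "\<And>\<beta> h. occ \<beta> \<psi> h \<Longrightarrow> img \<beta> h = J \<Longrightarrow> has_block \<beta> \<alpha>"
            "\<And>L. reduces \<psi> J L \<Longrightarrow> embeds \<alpha> \<pi> (R \<union> A' \<union> f ` L)"
          using block_cases[OF perm f, of "R \<union> A'" "{..<length \<psi>}" \<alpha>] emb
          unfolding B_def by blast
        have "occ \<psi> \<psi> id" by (simp add: occ_def)
        \<comment> \<open>Otherwise \<open>\<alpha>\<close> would have both blocks, and the
          induction hypothesis would give \<open>mobius [1] \<alpha> = 0\<close>.\<close>
        then have "J \<noteq> {..<length \<psi>}"
          using less.hyps[OF perm_less_length[OF \<alpha>] p\<alpha> True] nz J(2)[of \<psi> id] by auto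
        then show "embeds \<alpha> \<pi> (R \<union> A' \<union> f ` L)"
          using J red[OF p\<alpha> nz True, of J] by blast
      next
        assume "embeds \<alpha> \<pi> (R \<union> A' \<union> f ` L)"
        then show "embeds \<alpha> \<pi> (R \<union> A' \<union> B)" by (rule embeds_mono) (use fL in auto)
      qed
      then have eq: "\<And>A'. A' \<subseteq> A \<Longrightarrow>
          embeds \<alpha> \<pi> (R \<union> A' \<union> B) = embeds \<alpha> \<pi> (R \<union> A' \<union> f ` L)" .
      then have "(\<Sum>(c, K)\<leftarrow>cs. c * of_bool (embeds \<alpha> \<pi> (R \<union> e ` K \<union> B))) =
          (\<Sum>(c, K)\<leftarrow>cs. c * of_bool (embeds \<alpha> \<pi> (R \<union> e ` K \<union> f ` L)) :: int)"
        using eK(1) by (intro arg_cong[where f = sum_list] map_cong refl) (auto simp: case_prod_unfold)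
      then show ?thesis using eq[of A] unfolding ws by simp
    qed
  next
    have "(\<Sum>(c, K)\<leftarrow>cs. c * of_bool (embeds \<pi> \<pi> (R \<union> e ` K \<union> B'))) = (0 :: int)" if "B' \<subseteq> B" for B'
    proof -
      have "map (\<lambda>(c, K). c * of_bool (embeds \<pi> \<pi> (R \<union> e ` K \<union> B'))) cs = map (\<lambda>_. 0 :: int) cs"
        using eK self that by (intro map_cong refl) auto
      then show ?thesis by (simp only: sum_list_0)
    qed
    then show "(\<Sum>(c, Q)\<leftarrow>ws. c * of_bool (embeds \<pi> \<pi> Q)) = 1"
      using self fL unfolding ws by simp
  qed
qed

section \<open>The pair 12, 21 and the pattern 123\<close>

lemmas occ_simps = occ_def All_less_Suc

lemma occ_id: "occ \<sigma> \<sigma> id"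
  by (simp add: occ_def)

text \<open>Without a block 12 in \<open>\<alpha>\<close>, an embedding uses at most one of the two
  points, and a single point can be moved to the first place.\<close>

lemma resolves_12: "resolves [1, 2] [(1, {0})]"
  unfolding resolves_def
proof (intro conjI allI impI)
  fix \<pi> e Q \<alpha>
  assume \<pi>: "is_perm \<pi>" and e: "occ [1, 2] \<pi> e" "block \<pi> {..<length \<pi>} (img [1, 2] e)"
    and Q: "Q \<inter> img [1, 2] e = {}" and nb: "\<not> has_block [1, 2] \<alpha>"
  have "embeds \<alpha> \<pi> (Q \<union> e ` {0})" if u: "embeds \<alpha> \<pi> (Q \<union> img [1, 2] e)"
  proof (rule block_cases[OF \<pi> e Q order.refl u])
    fix J assume J: "J \<subseteq> {..<length [1, 2 :: nat]}"
      and hb: "\<And>\<beta> h. occ \<beta> [1, 2] h \<Longrightarrow> img \<beta> h = J \<Longrightarrow> has_block \<beta> \<alpha>"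
      and r: "\<And>L. reduces [1, 2] J L \<Longrightarrow> embeds \<alpha> \<pi> (Q \<union> e ` L)"
    have "J \<noteq> {0, 1}" using hb[OF occ_id] nb by (auto simp: lessThan_Suc)
    then consider "J \<subseteq> {0}" | "J \<subseteq> {1}" using J by (auto simp: lessThan_Suc)
    then have "reduces [1, 2] J {0}"
    proof cases
      case 1
      then show ?thesis
        by (intro reducesI[where \<beta> = "[1]" and js = "[0]" and ks = "[0]"]) (auto simp: occ_simps)
    next
      case 2
      then show ?thesis
        by (intro reducesI[where \<beta> = "[1]" and js = "[1]" and ks = "[0]"]) (auto simp: occ_simps)
    qed
    then show ?thesis by (rule r)
  qed
  moreover have "embeds \<alpha> \<pi> (Q \<union> img [1, 2] e)" if "embeds \<alpha> \<pi> (Q \<union> e ` {0})"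
    using that by (rule embeds_mono) auto
  ultimately show "of_bool (embeds \<alpha> \<pi> (Q \<union> img [1, 2] e)) =
      (\<Sum>(c, K)\<leftarrow>[(1 :: int, {0})]. c * of_bool (embeds \<alpha> \<pi> (Q \<union> e ` K)))"
    by (auto simp: lessThan_Suc)
qed (auto simp: lessThan_Suc)

text \<open>If the blocks share exactly one point, the remaining point of each lies outside the
  other and must compare alike with both of its points, which an ascent and a descent do not allow.
  They cannot share both points, as one pair rises and the other falls.\<close>

lemma blocks_disjoint_12_21: "blocks_disjoint [1, 2] [2, 1]"
  unfolding blocks_disjoint_def
proof (intro allI impI)
  fix \<pi> e f
  assume \<pi>: "is_perm \<pi>" and e: "occ [1, 2] \<pi> e" and E: "block \<pi> {..<length \<pi>} (img [1, 2] e)"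
    and f: "occ [2, 1] \<pi> f" and F: "block \<pi> {..<length \<pi>} (img [2, 1] f)"
  have im: "img [1, 2] e = {e 0, e 1}" "img [2, 1] f = {f 0, f 1}" by (auto simp: lessThan_Suc)
  have e': "e 0 < e 1" "\<pi> ! e 0 < \<pi> ! e 1" "e 0 < length \<pi>" "e 1 < length \<pi>"
    using e by (auto simp: occ_simps)
  have f': "f 0 < f 1" "\<pi> ! f 1 < \<pi> ! f 0" "f 0 < length \<pi>" "f 1 < length \<pi>"
    using f by (auto simp: occ_simps)
  have E': "(k < e 0 \<longleftrightarrow> k < e 1) \<and> (\<pi> ! k < \<pi> ! e 0 \<longleftrightarrow> \<pi> ! k < \<pi> ! e 1)"
    if "k < length \<pi>" "k \<noteq> e 0" "k \<noteq> e 1" for k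
    using E that unfolding block_def im by blast
  have F': "(k < f 0 \<longleftrightarrow> k < f 1) \<and> (\<pi> ! k < \<pi> ! f 0 \<longleftrightarrow> \<pi> ! k < \<pi> ! f 1)"
    if "k < length \<pi>" "k \<noteq> f 0" "k \<noteq> f 1" for k
    using F that unfolding block_def im by blast
  have inj: "\<pi> ! x = \<pi> ! y \<longleftrightarrow> x = y" if "x < length \<pi>" "y < length \<pi>" for x y
    using \<pi> that by (auto simp: is_perm_iff nth_eq_iff_index_eq)
  have "e 0 \<noteq> f 0"
    using e' f' E'[of "f 1"] F'[of "e 1"] by (cases "e 1 = f 1") auto
  moreover have "e 0 \<noteq> f 1"
  proof
    assume eq: "e 0 = f 1"
    then have "\<pi> ! f 0 < \<pi> ! e 1 \<longleftrightarrow> \<pi> ! f 0 < \<pi> ! f 1" "\<pi> ! e 1 < \<pi> ! f 0 \<longleftrightarrow> \<pi> ! e 1 < \<pi> ! f 1"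
      using e' f' E'[of "f 0"] F'[of "e 1"] by auto
    then show False using eq e' f' inj[of "e 1" "f 0"] by auto
  qed
  moreover have "e 1 \<noteq> f 0"
    using e' f' E'[of "f 1"] F'[of "e 0"] by auto
  moreover have "e 1 \<noteq> f 1"
    using e' f' E'[of "f 0"] F'[of "e 0"] by (cases "e 0 = f 0") auto
  ultimately show "img [1, 2] e \<inter> img [2, 1] f = {}" unfolding im by auto
qed

lemma mobius_eq_0_12_21:
  assumes "is_perm \<pi>" "has_block [1, 2] \<pi>" "has_block [2, 1] \<pi>"
  shows "mobius [1] \<pi> = 0"
proof (rule mobius_eq_0_block_pair[OF resolves_12 blocks_disjoint_12_21 _ _ _ _ assms, of "{0}"])
  fix J :: "nat set" assume "J \<subset> {..<length [2, 1 :: nat]}"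
  then consider "J \<subseteq> {0}" | "J \<subseteq> {1}" by (auto simp: lessThan_Suc)
  then show "reduces [2, 1] J {0}"
  proof cases
    case 1
    then show ?thesis
      by (intro reducesI[where \<beta> = "[1]" and js = "[0]" and ks = "[0]"]) (auto simp: occ_simps)
  next
    case 2
    then show ?thesis
      by (intro reducesI[where \<beta> = "[1]" and js = "[1]" and ks = "[0]"]) (auto simp: occ_simps)
  qed
qed (auto simp: lessThan_Suc)

text \<open>Any two points of 123 form an ascent and can be moved to the first two places. By
  induction a nonzero \<open>\<alpha>\<close> below \<open>\<pi>\<close> has no block 123, so it
  embeds into \<open>\<pi>\<close> with the third point deleted; this gives the weights 1 and
  -1.\<close>

lemma mobius_eq_0_123:
  assumes "is_perm \<pi>" "has_block [1, 2, 3] \<pi>"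
  shows "mobius [1] \<pi> = 0"
  using assms
proof (induction "length \<pi>" arbitrary: \<pi> rule: less_induct)
  case less
  note \<pi> = less.prems(1)
  obtain e where e: "occ [1, 2, 3] \<pi> e" "block \<pi> {..<length \<pi>} (img [1, 2, 3] e)"
    using less.prems(2) by (auto simp: has_block_def)
  define Q where "Q = {..<length \<pi>} - img [1, 2, 3] e"
  have Q: "Q \<inter> img [1, 2, 3] e = {}" "Q \<union> img [1, 2, 3] e = {..<length \<pi>}"
    using occ_subset[OF e(1)] by (auto simp: Q_def)
  have im: "img [1, 2, 3] e = {e 0, e 1, e 2}" by (auto simp: lessThan_Suc eval_nat_numeral)
  have e': "e 0 < e 1" "e 1 < e 2" "e 0 < length \<pi>" "e 1 < length \<pi>" "e 2 < length \<pi>"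
    using e(1) by (auto simp: occ_simps eval_nat_numeral)
  have sub: "Q \<union> e ` {0, 1} \<subseteq> {..<length \<pi>}" using e' by (auto simp: Q_def)
  have "e 2 \<notin> Q \<union> e ` {0, 1}" using e' by (simp add: Q_def im)
  then have ne: "Q \<union> e ` {0, 1} \<noteq> {..<length \<pi>}" using e'(5) by blast
  have two: "2 \<le> card A" if A: "e ` {0, 1} \<subseteq> A" "A \<subseteq> {..<length \<pi>}" for A
  proof -
    have "card (e ` {0, 1}) \<le> card A" by (intro card_mono finite_subset[OF A(2)] A(1)) simp
    then show ?thesis using e'(1) by simp
  qed
  show ?case
  proof (rule mobius_eq_0_if_weights[OF \<pi>, of "[(1, {..<length \<pi>}), (- 1, Q \<union> e ` {0, 1})]"])
    fix c A assume "(c, A) \<in> set [(1 :: int, {..<length \<pi>}), (- 1, Q \<union> e ` {0, 1})]"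
    then show "A \<subseteq> {..<length \<pi>} \<and> 2 \<le> card A"
      using two[of A] e' sub by auto
  next
    fix \<alpha> assume \<alpha>: "\<alpha> \<prec> \<pi>" and nz: "mobius [1] \<alpha> \<noteq> 0"
    have "is_perm \<alpha>" using \<alpha> by (simp add: perm_less_def perm_le_def)
    then have nb: "\<not> has_block [1, 2, 3] \<alpha>"
      using less.hyps[OF perm_less_length[OF \<alpha>]] nz by blast
    have u: "embeds \<alpha> \<pi> {..<length \<pi>}"
      using \<alpha> occ_subset unfolding perm_less_def perm_le_iff_occ embeds_def by blast
    have "embeds \<alpha> \<pi> (Q \<union> e ` {0, 1})"
    proof (rule block_cases[OF \<pi> e Q(1) order.refl u[folded Q(2)]])
      fix J assume J: "J \<subseteq> {..<length [1, 2, 3 :: nat]}"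
        and hb: "\<And>\<beta> h. occ \<beta> [1, 2, 3] h \<Longrightarrow> img \<beta> h = J \<Longrightarrow> has_block \<beta> \<alpha>"
        and r: "\<And>L. reduces [1, 2, 3] J L \<Longrightarrow> embeds \<alpha> \<pi> (Q \<union> e ` L)"
      have "J \<noteq> {0, 1, 2}" using hb[OF occ_id] nb by (auto simp: lessThan_Suc eval_nat_numeral)
      then consider "J \<subseteq> {0, 1}" | "J \<subseteq> {0, 2}" | "J \<subseteq> {1, 2}"
        using J by (auto simp: lessThan_Suc eval_nat_numeral)
      then have "reduces [1, 2, 3] J {0, 1}"
      proof cases
        case 1
        then show ?thesis
          by (intro reducesI[where \<beta> = "[1, 2]" and js = "[0, 1]" and ks = "[0, 1]"])
            (auto simp: occ_simps)
      next
        case 2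
        then show ?thesis
          by (intro reducesI[where \<beta> = "[1, 2]" and js = "[0, 2]" and ks = "[0, 1]"])
            (auto simp: occ_simps)
      next
        case 3
        then show ?thesis
          by (intro reducesI[where \<beta> = "[1, 2]" and js = "[1, 2]" and ks = "[0, 1]"])
            (auto simp: occ_simps)
      qed
      then show ?thesis by (rule r)
    qed
    then show "(\<Sum>(c, A)\<leftarrow>[(1, {..<length \<pi>}), (- 1, Q \<union> e ` {0, 1})].
        c * of_bool (embeds \<alpha> \<pi> A)) = (0 :: int)"
      using u by simp
  next
    show "(\<Sum>(c, A)\<leftarrow>[(1, {..<length \<pi>}), (- 1, Q \<union> e ` {0, 1})].
        c * of_bool (embeds \<pi> \<pi> A)) = (1 :: int)"
      using embeds_self_iff[OF sub] embeds_self_iff[of "{..<length \<pi>}" \<pi>] ne by simp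
  qed
qed

section \<open>Inner blocks of concrete patterns, and inclusion-exclusion for 312\<close>

lemma has_block_nthI:
  assumes "occ \<beta> \<psi> ((!) js)" "length js = length \<beta>" "block \<psi> {..<length \<psi>} (set js)"
  shows "has_block \<beta> \<psi>"
  using assms img_nth[OF assms(2)] unfolding has_block_def by (intro exI[of _ "(!) js"]) simp

text \<open>Through \<open>has_block_trans\<close>, this and the next three facts reduce larger
  patterns to 12, 21 and 123; a block 312 supplies the block 12 to be paired with 21.\<close>

lemma has_block_312_12: "has_block [1, 2] [3, 1, 2]"
  by (rule has_block_nthI[where js = "[1, 2]"]) (auto simp: occ_simps block_def less_Suc_eq)

lemma has_block_213_21: "has_block [2, 1] [2, 1, 3]"
  by (rule has_block_nthI[where js = "[0, 1]"]) (auto simp: occ_simps block_def less_Suc_eq)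

lemma has_block_1243_21: "has_block [2, 1] [1, 2, 4, 3]"
  by (rule has_block_nthI[where js = "[2, 3]"]) (auto simp: occ_simps block_def less_Suc_eq)

lemma has_block_2341_123: "has_block [1, 2, 3] [2, 3, 4, 1]"
  by (rule has_block_nthI[where js = "[0, 1, 2]"]) (auto simp: occ_simps block_def less_Suc_eq)

text \<open>The sets are the places of 12, of 21, and their common point. If \<open>\<alpha>\<close>
  has no block 312, an embedding can be made to go through 12 or 21. If both ways are possible, so
  is the point alone, since blocks 12 and 21 together force
  \<open>mobius [1] \<alpha> = 0\<close>.\<close>

lemma resolves_312: "resolves [3, 1, 2] [(1, {1, 2}), (1, {0, 1}), (- 1, {1})]"
  unfolding resolves_def
proof (intro conjI allI impI)
  fix \<pi> e Q \<alpha>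
  assume \<pi>: "is_perm \<pi>" and e: "occ [3, 1, 2] \<pi> e" "block \<pi> {..<length \<pi>} (img [3, 1, 2] e)"
    and Q: "Q \<inter> img [3, 1, 2] e = {}" and nb: "\<not> has_block [3, 1, 2] \<alpha>"
    and \<alpha>: "is_perm \<alpha>" and nz: "mobius [1] \<alpha> \<noteq> 0"
  have full: "{..<length [3, 1, 2 :: nat]} = {0, 1, 2}" by (auto simp: lessThan_Suc eval_nat_numeral)
  have "embeds \<alpha> \<pi> (Q \<union> e ` {1, 2}) \<or> embeds \<alpha> \<pi> (Q \<union> e ` {0, 1})"
    if u: "embeds \<alpha> \<pi> (Q \<union> img [3, 1, 2] e)"
  proof (rule block_cases[OF \<pi> e Q order.refl u])
    fix J assume J: "J \<subseteq> {..<length [3, 1, 2 :: nat]}"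
      and hb: "\<And>\<beta> h. occ \<beta> [3, 1, 2] h \<Longrightarrow> img \<beta> h = J \<Longrightarrow> has_block \<beta> \<alpha>"
      and r: "\<And>L. reduces [3, 1, 2] J L \<Longrightarrow> embeds \<alpha> \<pi> (Q \<union> e ` L)"
    have "J \<noteq> {0, 1, 2}" using hb[OF occ_id] nb full by auto
    then consider "J \<subseteq> {1, 2}" | "J \<subseteq> {0, 1}" | "J \<subseteq> {0, 2}" using J full by auto
    then have "reduces [3, 1, 2] J {1, 2} \<or> reduces [3, 1, 2] J {0, 1}"
    proof cases
      case 1
      then have "reduces [3, 1, 2] J {1, 2}"
        by (intro reducesI[where \<beta> = "[1, 2]" and js = "[1, 2]" and ks = "[1, 2]"]) (auto simp: occ_simps)
      then show ?thesis ..
    next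
      case 2
      then have "reduces [3, 1, 2] J {0, 1}"
        by (intro reducesI[where \<beta> = "[2, 1]" and js = "[0, 1]" and ks = "[0, 1]"]) (auto simp: occ_simps)
      then show ?thesis ..
    next
      case 3
      then have "reduces [3, 1, 2] J {0, 1}"
        by (intro reducesI[where \<beta> = "[2, 1]" and js = "[0, 2]" and ks = "[0, 1]"]) (auto simp: occ_simps)
      then show ?thesis ..
    qed
    then show ?thesis using r by blast
  qed
  moreover have "embeds \<alpha> \<pi> (Q \<union> img [3, 1, 2] e)"
    if "embeds \<alpha> \<pi> (Q \<union> e ` {1, 2}) \<or> embeds \<alpha> \<pi> (Q \<union> e ` {0, 1})"
    using that embeds_mono[of \<alpha> \<pi> _ "Q \<union> img [3, 1, 2] e"] unfolding full by blast
  moreover have "embeds \<alpha> \<pi> (Q \<union> e ` {1, 2})" "embeds \<alpha> \<pi> (Q \<union> e ` {0, 1})" if "embeds \<alpha> \<pi> (Q \<union> e ` {1})"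
    by (rule embeds_mono[OF that]; blast)+
  moreover have "embeds \<alpha> \<pi> (Q \<union> e ` {1})"
    if u: "embeds \<alpha> \<pi> (Q \<union> e ` {1, 2})" and v: "embeds \<alpha> \<pi> (Q \<union> e ` {0, 1})"
  proof (rule block_cases[OF \<pi> e Q _ u], goal_cases)
    case 1
    show ?case unfolding full by blast
  next
    case (2 I)
    show ?case
    proof (rule block_cases[OF \<pi> e Q _ v], goal_cases)
      case 1
      show ?case unfolding full by blast
    next
      case (2 J)
      show ?case
      \<comment> \<open>\<open>I\<close> and \<open>J\<close> come from two embeddings of the same
        \<open>\<alpha>\<close>. If both pairs are fully used, \<open>\<alpha>\<close> has blocks 12
        and 21; otherwise one embedding uses at most one point of the block, which moves to place
        1.\<close>
      proof (cases "I = {1, 2} \<and> J = {0, 1}")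
        case True
        have "has_block [1, 2] \<alpha>"
          by (rule \<open>\<And>\<beta> h. occ \<beta> [3, 1, 2] h \<Longrightarrow> img \<beta> h = I \<Longrightarrow> has_block \<beta> \<alpha>\<close>[of _ "(!) [1, 2]"])
            (auto simp: True occ_simps lessThan_Suc)
        moreover have "has_block [2, 1] \<alpha>"
          by (rule \<open>\<And>\<beta> h. occ \<beta> [3, 1, 2] h \<Longrightarrow> img \<beta> h = J \<Longrightarrow> has_block \<beta> \<alpha>\<close>[of _ "(!) [0, 1]"])
            (auto simp: True occ_simps lessThan_Suc)
        ultimately show ?thesis using mobius_eq_0_12_21[OF \<alpha>] nz by blast
      next
        case False
        have "reduces [3, 1, 2] {k} {1}" if "k < 3" for k
          using that
          by (intro reducesI[where \<beta> = "[1]" and js = "[k]" and ks = "[1]"]) (auto simp: occ_simps)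
        then have r: "reduces [3, 1, 2] K {1}" if "K \<subseteq> {k}" "k < 3" for K k
          using that unfolding reduces_def by (meson order.trans)
        have "I \<subseteq> {1} \<or> I \<subseteq> {2} \<or> J \<subseteq> {0} \<or> J \<subseteq> {1}"
          using False \<open>I \<subseteq> {1, 2}\<close> \<open>J \<subseteq> {0, 1}\<close> by auto
        then have "reduces [3, 1, 2] I {1} \<or> reduces [3, 1, 2] J {1}"
          using r[of _ 0] r[of _ 1] r[of _ 2] by auto
        then show ?thesis
          using \<open>\<And>L. reduces [3, 1, 2] I L \<Longrightarrow> embeds \<alpha> \<pi> (Q \<union> e ` L)\<close>
            \<open>\<And>L. reduces [3, 1, 2] J L \<Longrightarrow> embeds \<alpha> \<pi> (Q \<union> e ` L)\<close> by blast
      qed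
    qed
  qed
  ultimately have iffs:
    "embeds \<alpha> \<pi> (Q \<union> img [3, 1, 2] e) \<longleftrightarrow> embeds \<alpha> \<pi> (Q \<union> e ` {1, 2}) \<or> embeds \<alpha> \<pi> (Q \<union> e ` {0, 1})"
    "embeds \<alpha> \<pi> (Q \<union> e ` {1}) \<longleftrightarrow> embeds \<alpha> \<pi> (Q \<union> e ` {1, 2}) \<and> embeds \<alpha> \<pi> (Q \<union> e ` {0, 1})"
    by blast+
  have "of_bool u = 1 * of_bool a + (1 * of_bool b + (- 1 * of_bool c + (0 :: int)))"
    if "u \<longleftrightarrow> a \<or> b" "c \<longleftrightarrow> a \<and> b" for u a b c
    using that by auto
  from this[OF iffs] show "of_bool (embeds \<alpha> \<pi> (Q \<union> img [3, 1, 2] e)) =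
      (\<Sum>(c, K)\<leftarrow>[(1 :: int, {1, 2}), (1, {0, 1}), (- 1, {1})]. c * of_bool (embeds \<alpha> \<pi> (Q \<union> e ` K)))"
    by (simp only: list.map prod.case sum_list.Cons sum_list.Nil)
next
  have proper: "K \<subset> {..<length [3, 1, 2 :: nat]}" if "K \<subseteq> {..<3}" "k < 3" "k \<notin> K" for K k
    using that by auto
  show "\<forall>(c, K) \<in> set [(1 :: int, {1, 2}), (1, {0, 1}), (- 1, {1})].
      K \<noteq> {} \<and> K \<subset> {..<length [3, 1, 2 :: nat]}"
    using proper[of "{1, 2}" 0] proper[of "{0, 1}" 2] proper[of "{1}" 0] by simp
qed

section \<open>Skew sums and disjointness from a block 312\<close>

definition skew_indecomposable :: "nat list \<Rightarrow> bool" where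
  "skew_indecomposable \<psi> \<longleftrightarrow> (\<forall>T. T \<subseteq> {..<length \<psi>} \<longrightarrow> T \<noteq> {} \<longrightarrow>
     (\<forall>i \<in> T. \<forall>j \<in> {..<length \<psi>} - T. i < j \<longleftrightarrow> \<not> \<psi> ! i < \<psi> ! j) \<longrightarrow> T = {..<length \<psi>})"

text \<open>
  If two blocks overlap properly, then both split along the overlap in the same direction.
  As 312 only splits as a skew sum, the other block would be a skew sum as well.
\<close>

lemma blocks_disjoint_312:
  assumes len: "3 < length \<psi>" and ind: "skew_indecomposable \<psi>" and nb: "\<not> has_block [3, 1, 2] \<psi>"
  shows "blocks_disjoint [3, 1, 2] \<psi>"
  unfolding blocks_disjoint_def
proof (intro allI impI)
  fix \<pi> e f
  assume \<pi>: "is_perm \<pi>"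
    and e: "occ [3, 1, 2] \<pi> e" and E: "block \<pi> {..<length \<pi>} (img [3, 1, 2] e)"
    and f: "occ \<psi> \<pi> f" and F: "block \<pi> {..<length \<pi>} (img \<psi> f)"
  define C where "C = img [3, 1, 2] e"
  define D where "D = img \<psi> f"
  have C: "C = {e 0, e 1, e 2}" by (auto simp: C_def lessThan_Suc eval_nat_numeral)
  have e': "e 0 < e 1" "e 1 < e 2" "\<pi> ! e 1 < \<pi> ! e 2" "\<pi> ! e 2 < \<pi> ! e 0"
    using e by (auto simp: occ_simps eval_nat_numeral)
  have sub: "C \<subseteq> {..<length \<pi>}" "D \<subseteq> {..<length \<pi>}"
    using occ_subset[OF e] occ_subset[OF f] by (auto simp: C_def D_def)
  have E': "(k < x \<longleftrightarrow> k < y) \<and> (\<pi> ! k < \<pi> ! x \<longleftrightarrow> \<pi> ! k < \<pi> ! y)"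
    if "k \<in> {..<length \<pi>} - C" "x \<in> C" "y \<in> C" for k x y
    using E that unfolding block_def C_def by blast
  have F': "(k < x \<longleftrightarrow> k < y) \<and> (\<pi> ! k < \<pi> ! x \<longleftrightarrow> \<pi> ! k < \<pi> ! y)"
    if "k \<in> {..<length \<pi>} - D" "x \<in> D" "y \<in> D" for k x y
    using F that unfolding block_def D_def by blast
  have inj: "\<pi> ! x = \<pi> ! y \<longleftrightarrow> x = y" if "x < length \<pi>" "y < length \<pi>" for x y
    using \<pi> that by (auto simp: is_perm_iff nth_eq_iff_index_eq)
  have "\<not> C \<subseteq> D"
  proof
    assume "C \<subseteq> D"
    moreover from this have "block \<pi> D C" using E sub unfolding block_def C_def by blast
    ultimately show False using has_blockI[OF f e] nb by (simp add: C_def D_def)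
  qed
  show "img [3, 1, 2] e \<inter> img \<psi> f = {}"
  proof (rule ccontr)
    assume "img [3, 1, 2] e \<inter> img \<psi> f \<noteq> {}"
    then obtain t where t: "t \<in> C \<inter> D" by (auto simp: C_def D_def)
    \<comment> \<open>The entry 3 forms an inversion with both others. If it lies in the overlap it
      serves as \<open>s\<close>, otherwise as \<open>z\<close>.\<close>
    have "\<exists>z \<in> C - D. \<exists>s \<in> C \<inter> D. z < s \<longleftrightarrow> \<not> \<pi> ! z < \<pi> ! s"
    proof (cases "e 0 \<in> D")
      case True
      then obtain z where "z \<in> C - D" "z = e 1 \<or> z = e 2" using \<open>\<not> C \<subseteq> D\<close> C by auto
      then show ?thesis using True e' C by (intro bexI[of _ z] bexI[of _ "e 0"]) auto
    next
      case False
      then have "t = e 1 \<or> t = e 2" using t C by auto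
      then show ?thesis using False e' C t by (intro bexI[of _ "e 0"] bexI[of _ t]) auto
    qed
    then obtain z s where zs: "z \<in> C - D" "s \<in> C \<inter> D" "z < s \<longleftrightarrow> \<not> \<pi> ! z < \<pi> ! s" by blast
    \<comment> \<open>The inversion at \<open>z\<close> and \<open>s\<close> passes to
      \<open>z\<close> and \<open>w\<close> because \<open>z\<close> lies outside the block
      \<open>D\<close>, and then to \<open>t\<close> and \<open>w\<close> because \<open>w\<close>
      lies outside the block \<open>C\<close>.\<close>
    have skew: "t < w \<longleftrightarrow> \<not> \<pi> ! t < \<pi> ! w" if t: "t \<in> C \<inter> D" and w: "w \<in> D - C" for t w
    proof -
      have zw: "z < w \<longleftrightarrow> \<not> \<pi> ! z < \<pi> ! w" using F'[of z s w] zs w sub by auto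
      have "w < z \<longleftrightarrow> w < t" "\<pi> ! w < \<pi> ! z \<longleftrightarrow> \<pi> ! w < \<pi> ! t"
        using E'[of w z t] zs t w sub by auto
      moreover have "w \<noteq> z" "w \<noteq> t" "\<pi> ! w \<noteq> \<pi> ! z" "\<pi> ! w \<noteq> \<pi> ! t"
        using zs t w sub inj by auto
      ultimately show ?thesis using zw by linarith
    qed
    define T where "T = {i \<in> {..<length \<psi>}. f i \<in> C}"
    have "T \<noteq> {}" using t by (auto simp: T_def D_def)
    moreover have "i < j \<longleftrightarrow> \<not> \<psi> ! i < \<psi> ! j" if "i \<in> T" "j \<in> {..<length \<psi>} - T" for i j
    proof -
      have "f i \<in> C \<inter> D" "f j \<in> D - C" using that by (auto simp: T_def D_def)
      then show ?thesis
        using skew[of "f i" "f j"] occ_pos[OF f, of i j] occ_val[OF f, of i j] that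
        by (simp add: T_def)
    qed
    moreover have "T \<subseteq> {..<length \<psi>}" by (auto simp: T_def)
    \<comment> \<open>All pairs between \<open>T\<close> and the rest are inversions, so
      \<open>D\<close> would lie in the three-element set \<open>C\<close>, against
      \<open>3 < length \<psi>\<close>.\<close>
    ultimately have "T = {..<length \<psi>}" using ind unfolding skew_indecomposable_def by blast
    then have "D \<subseteq> C" by (auto simp: T_def D_def)
    then have "card D \<le> card C" by (rule card_mono[rotated]) (simp add: C)
    then show False using card_img[OF e] card_img[OF f] len by (simp add: C_def D_def)
  qed
qed

lemma skew_indecomposable_2314: "skew_indecomposable [2, 3, 1, 4]"
  unfolding skew_indecomposable_def
proof (intro allI impI)
  fix T :: "nat set"
  assume T: "T \<subseteq> {..<length [2, 3, 1, 4 :: nat]}" "T \<noteq> {}" and sep: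
    "\<forall>i \<in> T. \<forall>j \<in> {..<length [2, 3, 1, 4 :: nat]} - T. i < j \<longleftrightarrow> \<not> [2, 3, 1, 4 :: nat] ! i < [2, 3, 1, 4] ! j"
  have full: "{..<length [2, 3, 1, 4 :: nat]} = {0, 1, 2, 3}"
    by (auto simp: lessThan_Suc eval_nat_numeral)
  \<comment> \<open>The listed pairs are non-inversions forming a spanning tree of the places, and
    \<open>T\<close> cannot separate the ends of a non-inversion.\<close>
  have "i \<in> T \<longleftrightarrow> j \<in> T" if "(i, j) \<in> {(0, 1), (0, 3), (2, 3)}" for i j
    using that sep[rule_format, of i j] sep[rule_format, of j i] unfolding full
    by (cases "i \<in> T"; cases "j \<in> T"; auto)
  then have "0 \<in> T \<longleftrightarrow> 1 \<in> T" "0 \<in> T \<longleftrightarrow> 3 \<in> T" "2 \<in> T \<longleftrightarrow> 3 \<in> T" by auto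
  then show "T = {..<length [2, 3, 1, 4 :: nat]}" using T unfolding full by auto
qed

lemma skew_indecomposable_23514: "skew_indecomposable [2, 3, 5, 1, 4]"
  unfolding skew_indecomposable_def
proof (intro allI impI)
  fix T :: "nat set"
  assume T: "T \<subseteq> {..<length [2, 3, 5, 1, 4 :: nat]}" "T \<noteq> {}" and sep:
    "\<forall>i \<in> T. \<forall>j \<in> {..<length [2, 3, 5, 1, 4 :: nat]} - T.
       i < j \<longleftrightarrow> \<not> [2, 3, 5, 1, 4 :: nat] ! i < [2, 3, 5, 1, 4] ! j"
  have full: "{..<length [2, 3, 5, 1, 4 :: nat]} = {0, 1, 2, 3, 4}"
    by (auto simp: lessThan_Suc eval_nat_numeral)
  have "i \<in> T \<longleftrightarrow> j \<in> T" if "(i, j) \<in> {(0, 1), (0, 2), (0, 4), (3, 4)}" for i j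
    using that sep[rule_format, of i j] sep[rule_format, of j i] unfolding full
    by (cases "i \<in> T"; cases "j \<in> T"; auto)
  then have "0 \<in> T \<longleftrightarrow> 1 \<in> T" "0 \<in> T \<longleftrightarrow> 2 \<in> T" "0 \<in> T \<longleftrightarrow> 4 \<in> T" "3 \<in> T \<longleftrightarrow> 4 \<in> T" by auto
  then show "T = {..<length [2, 3, 5, 1, 4 :: nat]}" using T unfolding full by auto
qed

lemma occ_312D:
  assumes "occ [3, 1, 2] \<psi> g"
  shows "g 0 < g 1" "g 1 < g 2" "g 2 < length \<psi>" "\<psi> ! g 1 < \<psi> ! g 2" "\<psi> ! g 2 < \<psi> ! g 0"
  using assms by (auto simp: occ_simps eval_nat_numeral)

lemma not_has_block_312_2314: "\<not> has_block [3, 1, 2] [2, 3, 1, 4]"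
proof
  assume "has_block [3, 1, 2] [2, 3, 1, 4]"
  then obtain g where g: "occ [3, 1, 2] [2, 3, 1, 4] g" by (auto simp: has_block_def)
  have "g 2 = 2 \<or> g 2 = 3" "g 1 = 1 \<or> g 1 = 2" "g 0 = 0 \<or> g 0 = 1"
    using occ_312D(1-3)[OF g] by auto
  then show False using occ_312D[OF g] by auto
qed

text \<open>The only occurrence of 312 is 514, and the entry 3 outside it lies between 1 and 5 in
  value.\<close>

lemma not_has_block_312_23514: "\<not> has_block [3, 1, 2] [2, 3, 5, 1, 4]"
proof
  assume "has_block [3, 1, 2] [2, 3, 5, 1, 4]"
  then obtain g where g: "occ [3, 1, 2] [2, 3, 5, 1, 4] g"
    and b: "block [2, 3, 5, 1, 4] {..<length [2, 3, 5, 1, 4 :: nat]} (img [3, 1, 2] g)"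
    unfolding has_block_def by blast
  have "g 2 = 2 \<or> g 2 = 3 \<or> g 2 = 4" "g 1 = 1 \<or> g 1 = 2 \<or> g 1 = 3"
    "g 0 = 0 \<or> g 0 = 1 \<or> g 0 = 2"
    using occ_312D(1-3)[OF g] by auto
  then have g': "g 0 = 2" "g 1 = 3" "g 2 = 4" using occ_312D[OF g] by auto
  have "img [3, 1, 2] g = {2, 3, 4}"
    using g' by (auto simp: lessThan_Suc eval_nat_numeral)
  moreover have "(1 :: nat) \<in> {..<length [2, 3, 5, 1, 4 :: nat]} - {2, 3, 4}" by simp
  ultimately have "[2, 3, 5, 1, 4 :: nat] ! 1 < [2, 3, 5, 1, 4] ! 2 \<longleftrightarrow>
      [2, 3, 5, 1, 4 :: nat] ! 1 < [2, 3, 5, 1, 4] ! 3"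
    using b unfolding block_def by (metis insertCI)
  then show False by simp
qed

section \<open>The pairs (312, 2314) and (312, 23514)\<close>

lemma mobius_eq_0_312_2314:
  assumes "is_perm \<pi>" "has_block [3, 1, 2] \<pi>" "has_block [2, 3, 1, 4] \<pi>"
  shows "mobius [1] \<pi> = 0"
proof (rule mobius_eq_0_block_pair[OF resolves_312
      blocks_disjoint_312[OF _ skew_indecomposable_2314 not_has_block_312_2314] _ _ _ _ assms, of "{0, 1, 2}"])
  fix \<alpha> J
  assume \<alpha>: "is_perm \<alpha>" "mobius [1] \<alpha> \<noteq> 0" "has_block [3, 1, 2] \<alpha>"
    and J: "J \<subset> {..<length [2, 3, 1, 4 :: nat]}"
    and img_hb: "\<And>\<beta> h. occ \<beta> [2, 3, 1, 4] h \<Longrightarrow> img \<beta> h = J \<Longrightarrow> has_block \<beta> \<alpha>"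
  have hb: "has_block \<beta> \<alpha>"
    if "occ \<beta> [2, 3, 1, 4] ((!) js)" "length js = length \<beta>" "set js = J" for \<beta> js
    using img_hb[OF that(1)] that(2,3) img_nth by metis
  have full: "{..<length [2, 3, 1, 4 :: nat]} = {0, 1, 2, 3}"
    by (auto simp: lessThan_Suc eval_nat_numeral)
  \<comment> \<open>The block 312 contains a block 12, so a block 21 would make
    \<open>mobius [1] \<alpha>\<close> vanish.\<close>
  have no21: "\<not> has_block [2, 1] \<alpha>"
    using mobius_eq_0_12_21[OF \<alpha>(1) has_block_trans[OF has_block_312_12 \<alpha>(3)]] \<alpha>(2) by blast
  have no123: "\<not> has_block [1, 2, 3] \<alpha>" using mobius_eq_0_123[OF \<alpha>(1)] \<alpha>(2) by blast
  have "J \<noteq> {0, 1, 3}"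
    using no123 hb[of "[1, 2, 3]" "[0, 1, 3]"] by (auto simp: occ_simps)
  moreover have no213: "\<not> has_block [2, 1, 3] \<alpha>"
    using no21 has_block_trans[OF has_block_213_21] by blast
  then have "J \<noteq> {0, 2, 3}" "J \<noteq> {1, 2, 3}"
    using hb[of "[2, 1, 3]" "[0, 2, 3]"] hb[of "[2, 1, 3]" "[1, 2, 3]"]
    by (auto simp: occ_simps)
  moreover have sub: "J \<subseteq> K \<longleftrightarrow> (\<forall>i\<in>{0, 1, 2, 3}. i \<in> J \<longrightarrow> i \<in> K)" for K
    using J unfolding full by blast
  moreover have "J \<noteq> {0, 1, 2, 3}" using J full by simp
  \<comment> \<open>Of the three-point traces only \<open>{0, 1, 2}\<close>, the pattern 231,
    survives; the others give 123 or 213. A pair containing place 3, the entry 4, is an ascent and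
    moves to places 0 and 1.\<close>
  ultimately consider "J \<subseteq> {0, 1, 2}" | "J \<subseteq> {0, 3}" | "J \<subseteq> {1, 3}" | "J \<subseteq> {2, 3}"
    by (simp add: set_eq_subset) blast
  then show "reduces [2, 3, 1, 4] J {0, 1, 2}"
  proof cases
    case 1
    then show ?thesis
      by (intro reducesI[where \<beta> = "[2, 3, 1]" and js = "[0, 1, 2]" and ks = "[0, 1, 2]"])
        (auto simp: occ_simps)
  next
    case 2
    then show ?thesis
      by (intro reducesI[where \<beta> = "[1, 2]" and js = "[0, 3]" and ks = "[0, 1]"]) (auto simp: occ_simps)
  next
    case 3
    then show ?thesis
      by (intro reducesI[where \<beta> = "[1, 2]" and js = "[1, 3]" and ks = "[0, 1]"]) (auto simp: occ_simps)
  next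
    case 4
    then show ?thesis
      by (intro reducesI[where \<beta> = "[1, 2]" and js = "[2, 3]" and ks = "[0, 1]"]) (auto simp: occ_simps)
  qed
next
  have "(3 :: nat) \<in> {..<length [2, 3, 1, 4 :: nat]}" "(3 :: nat) \<notin> {0, 1, 2}" by simp_all
  then have "{0, 1, 2} \<noteq> {..<length [2, 3, 1, 4 :: nat]}" by blast
  then show "{0, 1, 2} \<subset> {..<length [2, 3, 1, 4 :: nat]}" by (intro psubsetI) simp_all
qed simp_all

text \<open>The entries 2 and 3 of 23514 form a block 12, so an embedding that misses either of them
  moves into the copy of 2413 at places 0, 2, 3, 4. For embeddings that use both, the vanishing
  results leave only traces inside 231, which also occurs in 2413.\<close>

lemma mobius_eq_0_312_23514:
  assumes "is_perm \<pi>" "has_block [3, 1, 2] \<pi>" "has_block [2, 3, 5, 1, 4] \<pi>"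
  shows "mobius [1] \<pi> = 0"
proof (rule mobius_eq_0_block_pair[OF resolves_312
      blocks_disjoint_312[OF _ skew_indecomposable_23514 not_has_block_312_23514] _ _ _ _ assms, of "{0, 2, 3, 4}"])
  fix \<alpha> J
  assume \<alpha>: "is_perm \<alpha>" "mobius [1] \<alpha> \<noteq> 0" "has_block [3, 1, 2] \<alpha>"
    and J: "J \<subset> {..<length [2, 3, 5, 1, 4 :: nat]}"
    and img_hb: "\<And>\<beta> h. occ \<beta> [2, 3, 5, 1, 4] h \<Longrightarrow> img \<beta> h = J \<Longrightarrow> has_block \<beta> \<alpha>"
  have hb: "has_block \<beta> \<alpha>"
    if "occ \<beta> [2, 3, 5, 1, 4] ((!) js)" "length js = length \<beta>" "set js = J" for \<beta> js
    using img_hb[OF that(1)] that(2,3) img_nth by metis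
  have full: "{..<length [2, 3, 5, 1, 4 :: nat]} = {0, 1, 2, 3, 4}"
    by (auto simp: lessThan_Suc eval_nat_numeral)
  have no21: "\<not> has_block [2, 1] \<alpha>"
    using mobius_eq_0_12_21[OF \<alpha>(1) has_block_trans[OF has_block_312_12 \<alpha>(3)]] \<alpha>(2) by blast
  have no123: "\<not> has_block [1, 2, 3] \<alpha>" using mobius_eq_0_123[OF \<alpha>(1)] \<alpha>(2) by blast
  \<comment> \<open>The excluded traces read 235, 234, 2351, 2354 and 2314. The first two have
    pattern 123, the third contains it as a block, the fourth has a block 21, and the last is the
    previous pair.\<close>
  have "J \<noteq> {0, 1, 2}" "J \<noteq> {0, 1, 4}"
    using no123 hb[of "[1, 2, 3]" "[0, 1, 2]"] hb[of "[1, 2, 3]" "[0, 1, 4]"]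
    by (auto simp: occ_simps)
  moreover have "J \<noteq> {0, 1, 2, 3}"
    using no123 has_block_trans[OF has_block_2341_123] hb[of "[2, 3, 4, 1]" "[0, 1, 2, 3]"]
    by (auto simp: occ_simps)
  moreover have "J \<noteq> {0, 1, 2, 4}"
    using no21 has_block_trans[OF has_block_1243_21] hb[of "[1, 2, 4, 3]" "[0, 1, 2, 4]"]
    by (auto simp: occ_simps)
  moreover have "\<not> has_block [2, 3, 1, 4] \<alpha>"
    using mobius_eq_0_312_2314[OF \<alpha>(1,3)] \<alpha>(2) by blast
  then have "J \<noteq> {0, 1, 3, 4}"
    using hb[of "[2, 3, 1, 4]" "[0, 1, 3, 4]"] by (auto simp: occ_simps)
  moreover have sub: "J \<subseteq> K \<longleftrightarrow> (\<forall>i\<in>{0, 1, 2, 3, 4}. i \<in> J \<longrightarrow> i \<in> K)" for K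
    using J unfolding full by blast
  moreover have "J \<noteq> {0, 1, 2, 3, 4}" using J full by simp
  ultimately consider "J \<subseteq> {0, 2, 3, 4}" | "J \<subseteq> {1, 2, 3, 4}" | "J \<subseteq> {0, 1}" | "J \<subseteq> {0, 1, 3}"
    by (simp add: set_eq_subset) blast
  then show "reduces [2, 3, 5, 1, 4] J {0, 2, 3, 4}"
  proof cases
    case 1
    then show ?thesis
      by (intro reducesI[where \<beta> = "[2, 4, 1, 3]" and js = "[0, 2, 3, 4]" and ks = "[0, 2, 3, 4]"])
        (auto simp: occ_simps)
  next
    case 2
    then show ?thesis
      by (intro reducesI[where \<beta> = "[2, 4, 1, 3]" and js = "[1, 2, 3, 4]" and ks = "[0, 2, 3, 4]"])
        (auto simp: occ_simps)
  next
    case 3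
    then show ?thesis
      by (intro reducesI[where \<beta> = "[1, 2]" and js = "[0, 1]" and ks = "[0, 2]"]) (auto simp: occ_simps)
  next
    case 4
    then show ?thesis
      by (intro reducesI[where \<beta> = "[2, 3, 1]" and js = "[0, 1, 3]" and ks = "[0, 2, 3]"])
        (auto simp: occ_simps)
  qed
next
  have "(1 :: nat) \<in> {..<length [2, 3, 5, 1, 4 :: nat]}" "(1 :: nat) \<notin> {0, 2, 3, 4}" by simp_all
  then have "{0, 2, 3, 4} \<noteq> {..<length [2, 3, 5, 1, 4 :: nat]}" by blast
  then show "{0, 2, 3, 4} \<subset> {..<length [2, 3, 5, 1, 4 :: nat]}" by (intro psubsetI) simp_all
qed simp_all

section \<open>The blocks of an inflation, and the annihilator pair\<close>

lemma has_block_append: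
  assumes p: "is_perm (xs @ map ((+) c) b @ ys)"
    and sep: "\<And>v. v \<in> set xs \<union> set ys \<Longrightarrow> v \<le> c \<or> c + length b < v" and b: "is_perm b"
  shows "has_block b (xs @ map ((+) c) b @ ys)"
  unfolding has_block_def
proof (intro exI conjI)
  let ?p = "xs @ map ((+) c) b @ ys" and ?g = "\<lambda>i. length xs + i"
  have nth: "?p ! ?g i = c + b ! i" if "i < length b" for i using that by (simp add: nth_append)
  show "occ b ?p ?g" by (simp add: occ_def nth del: nth_append_length_plus)
  show "block ?p {..<length ?p} (img b ?g)"
    unfolding block_def
  proof (intro conjI ballI)
    fix k x y assume k: "k \<in> {..<length ?p} - img b ?g" and x: "x \<in> img b ?g" and y: "y \<in> img b ?g"
    obtain i j where ij: "i < length b" "j < length b" "x = ?g i" "y = ?g j" using x y by auto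
    \<comment> \<open>The entries of \<open>b\<close> start at 1, so the block takes the values
      \<open>c + 1\<close> to \<open>c + length b\<close>, exactly the range that \<open>sep\<close>
      keeps free.\<close>
    have bij: "b ! i \<in> {1..length b}" "b ! j \<in> {1..length b}"
      using b ij nth_mem unfolding is_perm_iff by metis+
    have out: "k < length xs \<or> length xs + length b \<le> k"
    proof (rule ccontr)
      assume "\<not> ?thesis"
      then have "k = ?g (k - length xs)" "k - length xs < length b" by auto
      then show False using k by blast
    qed
    then show "k < x \<longleftrightarrow> k < y" using ij by auto
    have "?p ! k \<in> set xs \<union> set ys"
      using out k by (auto simp: nth_append)
    then show "?p ! k < ?p ! x \<longleftrightarrow> ?p ! k < ?p ! y"
      using sep[of "?p ! k"] bij nth ij by auto
  qed auto
qed

text \<open>The value ranges of the blocks are stacked in the order of the entries of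
  \<open>\<tau>\<close>, so every other block lies entirely below or above the one at
  \<open>i\<close>.\<close>

lemma has_block_inflate:
  assumes \<tau>: "is_perm \<tau>" and len: "length bs = length \<tau>" and bs: "\<forall>b \<in> set bs. is_perm b"
    and i: "i < length \<tau>"
  shows "has_block (bs ! i) (inflate \<tau> bs)"
proof -
  define off where "off k = (\<Sum>l | l < length \<tau> \<and> \<tau> ! l < \<tau> ! k. length (bs ! l))" for k
  define B where "B k = map ((+) (off k)) (bs ! k)" for k
  have "[0..<length \<tau>] = [0..<i] @ i # [Suc i..<length \<tau>]"
    using i by (metis le_add_same_cancel1 less_imp_le_nat upt_add_eq_append upt_conv_Cons zero_le
        le_add_diff_inverse add_0)
  then have infl: "inflate \<tau> bs =
      concat (map B [0..<i]) @ map ((+) (off i)) (bs ! i) @ concat (map B [Suc i..<length \<tau>])"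
    by (simp add: inflate_def B_def[abs_def] off_def)
  have step: "off k + length (bs ! k) \<le> off l"
    if "k < length \<tau>" "l < length \<tau>" "\<tau> ! k < \<tau> ! l" for k l
  proof -
    have "off k + length (bs ! k) =
        (\<Sum>m \<in> insert k {m. m < length \<tau> \<and> \<tau> ! m < \<tau> ! k}. length (bs ! m))"
      by (simp add: off_def)
    also have "\<dots> \<le> off l" unfolding off_def by (rule sum_mono2) (use that in auto)
    finally show ?thesis .
  qed
  have B: "set (B k) = {off k + 1..off k + length (bs ! k)}" if "k < length \<tau>" for k
    using bs len that by (simp add: B_def is_perm_iff)
  show ?thesis
    unfolding infl
  proof (rule has_block_append)
    show "is_perm (concat (map B [0..<i]) @ map ((+) (off i)) (bs ! i) @ concat (map B [Suc i..<length \<tau>]))"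
      using is_perm_inflate[OF \<tau> len bs] unfolding infl .
    show "is_perm (bs ! i)" using bs len i by simp
    fix v assume "v \<in> set (concat (map B [0..<i])) \<union> set (concat (map B [Suc i..<length \<tau>]))"
    then have "\<exists>k \<in> {0..<i} \<union> {Suc i..<length \<tau>}. v \<in> set (B k)" by auto
    then obtain k where "k \<in> {0..<i} \<union> {Suc i..<length \<tau>}" and v: "v \<in> set (B k)" ..
    then have k: "k < length \<tau>" "k \<noteq> i" using i by auto
    then have "\<tau> ! k < \<tau> ! i \<or> \<tau> ! i < \<tau> ! k"
      using \<tau> i by (metis is_perm_iff linorder_neqE_nat nth_eq_iff_index_eq)
    then show "v \<le> off i \<or> off i + length (bs ! i) < v"
      using step[of k i] step[of i k] k v i by (auto simp: B)
  qed
qed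

theorem theorem6p3: "annihilator_pair [3, 1, 2] [2, 3, 5, 1, 4]"
  unfolding annihilator_pair_def
proof (intro conjI allI impI)
  show perms: "is_perm [3, 1, 2]" "is_perm [2, 3, 5, 1, 4]"
    by (auto simp: is_perm_iff)
  fix \<tau> i j
  assume "is_perm \<tau> \<and> i < length \<tau> \<and> j < length \<tau> \<and> i \<noteq> j"
  then have \<tau>: "is_perm \<tau>" "i < length \<tau>" "j < length \<tau>" "i \<noteq> j" by auto
  define bs where "bs = (replicate (length \<tau>) [1])[i := [3, 1, 2], j := [2, 3, 5, 1, 4 :: nat]]"
  have "is_perm [1]" by (auto simp: is_perm_iff)
  then have perm_bs: "\<forall>b \<in> set bs. is_perm b"
    using perms unfolding bs_def
    by (auto dest!: subsetD[OF set_update_subset_insert])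
  have len: "length bs = length \<tau>" by (simp add: bs_def)
  \<comment> \<open>As \<open>i \<noteq> j\<close>, the second list update leaves the block 312 at
    \<open>i\<close> in place.\<close>
  have "has_block [3, 1, 2] (inflate \<tau> bs)" "has_block [2, 3, 5, 1, 4] (inflate \<tau> bs)"
    using has_block_inflate[OF \<tau>(1) len perm_bs, of i] has_block_inflate[OF \<tau>(1) len perm_bs, of j] \<tau>
    by (simp_all add: bs_def)
  then show "mobius [1] (inflate2 \<tau> i j [3, 1, 2] [2, 3, 5, 1, 4]) = 0"
    using mobius_eq_0_312_23514[OF is_perm_inflate[OF \<tau>(1) len perm_bs]]
    by (simp add: inflate2_def bs_def)
qed auto

end
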